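(* Let $p\ge 1$ be an integer, let $\Xi_1,\Xi_2,\Xi_3$ be $p$-open knot vectors on $[0,1]$ whose internal knots have multiplicity at most $p$, let $\mathcal M$ be the associated tensor product mesh of $\widehat\Omega=(0,1)^3$ (including empty cells), and consider the spline complex of equal degrees $p_1=p_2=p_3=p$ $$\mathbb R\longrightarrow \hat X^0_h \xrightarrow{\ \mathrm{grad}\ } \hat X^1_h \xrightarrow{\ \mathrm{curl}\ } \hat X^2_h \xrightarrow{\ \mathrm{div}\ } \hat X^3_h\longrightarrow 0 .$$ Then: (i) if $p$ is odd, the spline complex is isomorphic to the cochain complex associated with the partition $\mathcal M$; (ii) if $p$ is even, the spline complex is isomorphic to the chain complex associated with the partition $\mathcal M$ without its boundary, that is, the chain complex in which only the interior geometrical entities (faces, edges and vertices) of $\mathcal M$ are taken into account.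
   Context: **Knot vectors and univariate splines.** A $p$-open knot vector on $[0,1]$ is $\Xi=\{\xi_1,\dots,\xi_{n+p+1}\}$ with $0=\xi_1=\dots=\xi_{p+1}<\xi_{p+2}\le\dots\le\xi_n<\xi_{n+1}=\dots=\xi_{n+p+1}=1$. The B-splines are defined by $N_{i,0}(\zeta)=1$ if $\xi_i\le\zeta<\xi_{i+1}$ and $0$ otherwise, and for $p\ge1$ $$N_{i,p}(\zeta)=\frac{\zeta-\xi_i}{\xi_{i+p}-\xi_i}N_{i,p-1}(\zeta)+\frac{\xi_{i+p+1}-\zeta}{\xi_{i+p+1}-\xi_{i+1}}N_{i+1,p-1}(\zeta)$$ (with $0/0:=0$), $i=1,\dots,n$. Their real span is $S_p(\Xi)$, of dimension $n$; it consists of piecewise polynomials of degree $p$ with $p-m_j$ continuous derivatives at an internal knot of multiplicity $m_j$. Put $\Xi'=\{\xi_2,\dots,\xi_{n+p}\}$, a $(p-1)$-open knot vector; the derivative maps $S_p(\Xi)$ to $S_{p-1}(\Xi')$. **Spline spaces.** $S_{q_1,q_2,q_3}(\cdot,\cdot,\cdot)$ denotes the tensor product of univariate spline spaces of degrees $q_1,q_2,q_3$. With $p_1=p_2=p_3=p$ and $\Xi_\ell=\{\xi_{\ell,1},\dots,\xi_{\ell,n_\ell+p+1}\}$, $$\hat X^0_h=S_{p,p,p}(\Xi_1,\Xi_2,\Xi_3),$$ $$\hat X^1_h=S_{p-1,p,p}(\Xi_1',\Xi_2,\Xi_3)\times S_{p,p-1,p}(\Xi_1,\Xi_2',\Xi_3)\times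 S_{p,p,p-1}(\Xi_1,\Xi_2,\Xi_3'),$$ $$\hat X^2_h=S_{p,p-1,p-1}(\Xi_1,\Xi_2',\Xi_3')\times S_{p-1,p,p-1}(\Xi_1',\Xi_2,\Xi_3')\times S_{p-1,p-1,p}(\Xi_1',\Xi_2',\Xi_3),$$ $$\hat X^3_h=S_{p-1,p-1,p-1}(\Xi_1',\Xi_2',\Xi_3').$$ Differential operators are taken with respect to the coordinates of $\widehat\Omega$ (in the weak, i.e. piecewise, sense); the map $\mathbb R\to\hat X^0_h$ is the inclusion of constants. **The mesh $\mathcal M$.** In one dimension the mesh associated with $\Xi$ (degree $p$) is the collection of knot spans $(\xi_i,\xi_{i+1})$, $i=\lceil p/2\rceil+1,\dots,n+\lfloor p/2\rfloor$, including empty ones; its vertices are the knots $\xi_i$, $i=\lceil p/2\rceil+1,\dots,n+\lfloor p/2\rfloor+1$, counted separately even if their values coincide (repeated knots are treated as distinct vertices joined by edges of zero length). So each of the boundary values $0$ and $1$ appears with multiplicity $\lfloor p/2\rfloor+1$. The mesh $\mathcal M$ of $\widehat\Omega$ is the tensor product of the three one-dimensional meshes, regarded combinatorially as a Cartesian cell complex: its elements, faces, edges and vertices include those of zero length, area or volume. A vertex, edge or face is a boundary entity if it lies on one of the outermost mesh planes (those of first or last index in some direction), and is interior otherwise. **Cochain and chain complexes.** With all cells oriented, the cochain complex of $\mathcal M$ (real coefficients) is $C^0\to C^1\to C^2\to C^3$, where $C^k$ is the space of real functions on the $k$-cells of $\mathcal M$ (vertices, edges, faces, elements for $k=0,1,2,3$)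 and the maps are the coboundary operators, i.e. those represented by the edge-vertex, face-edge and element-face incidence matrices. The chain complex of $\mathcal M$ without its boundary is $C_3\to C_2^{\rm int}\to C_1^{\rm int}\to C_0^{\rm int}$, where $C_3$ is spanned by the elements of $\mathcal M$, $C^{\rm int}_k$ ($k=2,1,0$) is spanned by the interior $k$-cells (faces, edges, vertices), and the maps are the boundary operators in which boundary cells are discarded. **Isomorphism.** Isomorphism means isomorphism of complexes: linear isomorphisms $\hat X^j_h\cong C^j$ in case (i), respectively $\hat X^0_h\cong C_3$, $\hat X^1_h\cong C_2^{\rm int}$, $\hat X^2_h\cong C_1^{\rm int}$, $\hat X^3_h\cong C_0^{\rm int}$ in case (ii), intertwining $\mathrm{grad},\mathrm{curl},\mathrm{div}$ with the corresponding operators of the cochain (chain) complex. *)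

theory Defs
  imports "HOL-Analysis.Analysis"
begin

section \<open>Knot vectors and univariate splines\<close>

text \<open>
  A knot vector of degree p is given by n and a function \<open>\<xi>\<close> of which only the values at the
  indices 1, ..., n + p + 1 matter. The condition n > p is implicit in the chain
  \<open>\<xi> (p + 1) < \<xi> (p + 2) \<le> \<dots> \<le> \<xi> n < \<xi> (n + 1)\<close>, which for n = p + 1 (no internal knots)
  reads \<open>0 = \<xi> (p + 1) < \<xi> (p + 2) = 1\<close>.
\<close>

definition open_knot_vector :: "nat \<Rightarrow> nat \<Rightarrow> (nat \<Rightarrow> real) \<Rightarrow> bool" where
  "open_knot_vector p n \<xi> \<longleftrightarrow>
     p + 1 \<le> n \<and>
     (\<forall>i\<in>{1..p + 1}. \<xi> i = 0) \<and>
     \<xi> (p + 1) < \<xi> (p + 2) \<and>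
     (\<forall>i\<in>{p + 2..<n}. \<xi> i \<le> \<xi> (i + 1)) \<and>
     \<xi> n < \<xi> (n + 1) \<and>
     (\<forall>i\<in>{n + 1..n + p + 1}. \<xi> i = 1)"

definition internal_multiplicities_le :: "nat \<Rightarrow> nat \<Rightarrow> nat \<Rightarrow> (nat \<Rightarrow> real) \<Rightarrow> bool" where
  "internal_multiplicities_le m p n \<xi> \<longleftrightarrow>
     (\<forall>t. 0 < t \<and> t < 1 \<longrightarrow> card {i \<in> {1..n + p + 1}. \<xi> i = t} \<le> m)"

text \<open>The Cox--de Boor recursion; the convention 0/0 = 0 is that of division in HOL.\<close>

primrec bspline :: "(nat \<Rightarrow> real) \<Rightarrow> nat \<Rightarrow> nat \<Rightarrow> real \<Rightarrow> real" where
  "bspline \<xi> 0 i \<zeta> = (if \<xi> i \<le> \<zeta> \<and> \<zeta> < \<xi> (i + 1) then 1 else 0)"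
| "bspline \<xi> (Suc q) i \<zeta> =
     (\<zeta> - \<xi> i) / (\<xi> (i + Suc q) - \<xi> i) * bspline \<xi> q i \<zeta> +
     (\<xi> (i + Suc q + 1) - \<zeta>) / (\<xi> (i + Suc q + 1) - \<xi> (i + 1)) * bspline \<xi> q (i + 1) \<zeta>"

definition spline_space :: "nat \<Rightarrow> nat \<Rightarrow> (nat \<Rightarrow> real) \<Rightarrow> (real \<Rightarrow> real) set" where
  "spline_space p n \<xi> = {s. \<exists>c. s = (\<lambda>\<zeta>. \<Sum>i=1..n. c i * bspline \<xi> p i \<zeta>)}"

text \<open>
  The knot vector \<open>\<xi> 2, \<dots>, \<xi> (n + p)\<close>, renumbered to start at 1. It has degree p - 1 and
  n - 1 basis functions.
\<close>

definition trimmed_knots :: "(nat \<Rightarrow> real) \<Rightarrow> nat \<Rightarrow> real" where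
  "trimmed_knots \<xi> = (\<lambda>i. \<xi> (i + 1))"

definition trimmed_spline_space :: "nat \<Rightarrow> nat \<Rightarrow> (nat \<Rightarrow> real) \<Rightarrow> (real \<Rightarrow> real) set" where
  "trimmed_spline_space p n \<xi> = spline_space (p - 1) (n - 1) (trimmed_knots \<xi>)"

section \<open>The spline complex\<close>

definition unit_cube :: "(real^3) set" where
  "unit_cube = {x. \<forall>l. 0 < x $ l \<and> x $ l < 1}"

text \<open>Functions on the open unit cube are represented by their extension by zero.\<close>

definition tensor_space :: "(3 \<Rightarrow> (real \<Rightarrow> real) set) \<Rightarrow> (real^3 \<Rightarrow> real) set" where
  "tensor_space V = {u. \<exists>(m::nat) f. (\<forall>j<m. \<forall>l. f j l \<in> V l) \<and>
     u = (\<lambda>x. if x \<in> unit_cube then \<Sum>j<m. \<Prod>l\<in>UNIV. f j l (x $ l) else 0)}"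

text \<open>
  In the following, p is the common degree, and \<open>n l\<close>, \<open>\<xi> l\<close> give the knot vector in direction l.
\<close>

definition X0h :: "nat \<Rightarrow> (3 \<Rightarrow> nat) \<Rightarrow> (3 \<Rightarrow> nat \<Rightarrow> real) \<Rightarrow> (real^3 \<Rightarrow> real) set" where
  "X0h p n \<xi> = tensor_space (\<lambda>l. spline_space p (n l) (\<xi> l))"

definition X1h :: "nat \<Rightarrow> (3 \<Rightarrow> nat) \<Rightarrow> (3 \<Rightarrow> nat \<Rightarrow> real) \<Rightarrow> (real^3 \<Rightarrow> real^3) set" where
  "X1h p n \<xi> = {v. \<forall>k. (\<lambda>x. v x $ k) \<in> tensor_space
     (\<lambda>l. if l = k then trimmed_spline_space p (n l) (\<xi> l) else spline_space p (n l) (\<xi> l))}"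

definition X2h :: "nat \<Rightarrow> (3 \<Rightarrow> nat) \<Rightarrow> (3 \<Rightarrow> nat \<Rightarrow> real) \<Rightarrow> (real^3 \<Rightarrow> real^3) set" where
  "X2h p n \<xi> = {v. \<forall>k. (\<lambda>x. v x $ k) \<in> tensor_space
     (\<lambda>l. if l = k then spline_space p (n l) (\<xi> l) else trimmed_spline_space p (n l) (\<xi> l))}"

definition X3h :: "nat \<Rightarrow> (3 \<Rightarrow> nat) \<Rightarrow> (3 \<Rightarrow> nat \<Rightarrow> real) \<Rightarrow> (real^3 \<Rightarrow> real) set" where
  "X3h p n \<xi> = tensor_space (\<lambda>l. trimmed_spline_space p (n l) (\<xi> l))"

text \<open>
  The piecewise differential operators are relations: u is differentiable away from the knot planes
  and v agrees there with the classical gradient, curl or divergence of u. Below, v also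
  belongs to a given spline space, where it is determined by these values.
\<close>

definition off_knot_planes :: "nat \<Rightarrow> (3 \<Rightarrow> nat) \<Rightarrow> (3 \<Rightarrow> nat \<Rightarrow> real) \<Rightarrow> (real^3) set" where
  "off_knot_planes p n \<xi> = {x \<in> unit_cube. \<forall>l. x $ l \<notin> \<xi> l ` {1..n l + p + 1}}"

definition grad_on :: "(real^3) set \<Rightarrow> (real^3 \<Rightarrow> real) \<Rightarrow> (real^3 \<Rightarrow> real^3) \<Rightarrow> bool" where
  "grad_on M u v \<longleftrightarrow> (\<forall>x\<in>M. GDERIV u x :> v x)"

definition curl_on :: "(real^3) set \<Rightarrow> (real^3 \<Rightarrow> real^3) \<Rightarrow> (real^3 \<Rightarrow> real^3) \<Rightarrow> bool" where
  "curl_on M u v \<longleftrightarrow> (\<forall>x\<in>M. u differentiable (at x) \<and>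
     (let J = jacobian u (at x)
      in v x = vector [J $ 3 $ 2 - J $ 2 $ 3, J $ 1 $ 3 - J $ 3 $ 1, J $ 2 $ 1 - J $ 1 $ 2]))"

definition div_on :: "(real^3) set \<Rightarrow> (real^3 \<Rightarrow> real^3) \<Rightarrow> (real^3 \<Rightarrow> real) \<Rightarrow> bool" where
  "div_on M u v \<longleftrightarrow> (\<forall>x\<in>M. u differentiable (at x) \<and> v x = trace (jacobian u (at x)))"

section \<open>The mesh as an oriented Cartesian cell complex\<close>

text \<open>
  Cells are labelled by knot indices, so that cells of zero size remain distinct:
  \<open>Vertex i\<close> is the knot \<open>\<xi> i\<close>, and \<open>Edge i\<close> is the knot span from \<open>Vertex i\<close> to \<open>Vertex (i + 1)\<close>.
  Note \<open>\<lceil>p/2\<rceil> = (p + 1) div 2\<close> and \<open>\<lfloor>p/2\<rfloor> = p div 2\<close>.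
\<close>

datatype cell1 = Vertex nat | Edge nat

type_synonym cell = "cell1 \<times> cell1 \<times> cell1"

definition first_vertex :: "nat \<Rightarrow> nat" where
  "first_vertex p = (p + 1) div 2 + 1"

definition last_vertex :: "nat \<Rightarrow> nat \<Rightarrow> nat" where
  "last_vertex p n = n + p div 2 + 1"

definition mesh1 :: "nat \<Rightarrow> nat \<Rightarrow> cell1 set" where
  "mesh1 p n = Vertex ` {first_vertex p..last_vertex p n} \<union>
               Edge ` {first_vertex p..<last_vertex p n}"

fun dim1 :: "cell1 \<Rightarrow> nat" where
  "dim1 (Vertex i) = 0"
| "dim1 (Edge i) = 1"

fun cell_dim :: "cell \<Rightarrow> nat" where
  "cell_dim (a, b, c) = dim1 a + dim1 b + dim1 c"

definition mesh_cells :: "nat \<Rightarrow> (3 \<Rightarrow> nat) \<Rightarrow> nat \<Rightarrow> cell set" where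
  "mesh_cells p n k =
     {\<sigma> \<in> mesh1 p (n 1) \<times> mesh1 p (n 2) \<times> mesh1 p (n 3). cell_dim \<sigma> = k}"

definition boundary_vertices1 :: "nat \<Rightarrow> nat \<Rightarrow> cell1 set" where
  "boundary_vertices1 p n = {Vertex (first_vertex p), Vertex (last_vertex p n)}"

definition interior_cells :: "nat \<Rightarrow> (3 \<Rightarrow> nat) \<Rightarrow> nat \<Rightarrow> cell set" where
  "interior_cells p n k = {(a, b, c) \<in> mesh_cells p n k.
     a \<notin> boundary_vertices1 p (n 1) \<and>
     b \<notin> boundary_vertices1 p (n 2) \<and>
     c \<notin> boundary_vertices1 p (n 3)}"

fun incidence1 :: "cell1 \<Rightarrow> cell1 \<Rightarrow> real" where
  "incidence1 (Vertex i) (Edge j) = (if i = j + 1 then 1 else if i = j then - 1 else 0)"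
| "incidence1 _ _ = 0"

text \<open>
  The coefficient of the first cell in the boundary of the second one, both with their product
  orientation, from \<open>\<partial>(a \<times> b \<times> c) = \<partial>a \<times> b \<times> c + (-1)\<^bsup>dim a\<^esup> a \<times> \<partial>b \<times> c + (-1)\<^bsup>dim a + dim b\<^esup> a \<times> b \<times> \<partial>c\<close>.
\<close>

fun product_incidence :: "cell \<Rightarrow> cell \<Rightarrow> real" where
  "product_incidence (a', b', c') (a, b, c) =
     (if b' = b \<and> c' = c then incidence1 a' a else 0) +
     (if a' = a \<and> c' = c then (- 1) ^ dim1 a * incidence1 b' b else 0) +
     (if a' = a \<and> b' = b then (- 1) ^ (dim1 a + dim1 b) * incidence1 c' c else 0)"

text \<open>
  An arbitrary orientation of the cells is given by signs relative to the product orientation.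
\<close>

definition orientation :: "(cell \<Rightarrow> real) \<Rightarrow> bool" where
  "orientation \<omega> \<longleftrightarrow> (\<forall>\<sigma>. \<omega> \<sigma> = 1 \<or> \<omega> \<sigma> = - 1)"

definition incidence :: "(cell \<Rightarrow> real) \<Rightarrow> cell \<Rightarrow> cell \<Rightarrow> real" where
  "incidence \<omega> \<sigma> \<tau> = \<omega> \<sigma> * \<omega> \<tau> * product_incidence \<sigma> \<tau>"

text \<open>
  Cochains on a finite set of cells, and likewise chains (formal linear combinations of cells),
  are functions that vanish outside this set.
\<close>

definition functions_on_cells :: "cell set \<Rightarrow> (cell \<Rightarrow> real) set" where
  "functions_on_cells S = {c. \<forall>\<sigma>. \<sigma> \<notin> S \<longrightarrow> c \<sigma> = 0}"

definition coboundary ::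
    "(cell \<Rightarrow> real) \<Rightarrow> cell set \<Rightarrow> cell set \<Rightarrow> (cell \<Rightarrow> real) \<Rightarrow> cell \<Rightarrow> real" where
  "coboundary \<omega> S T c = (\<lambda>\<tau>. if \<tau> \<in> T then \<Sum>\<sigma>\<in>S. incidence \<omega> \<sigma> \<tau> * c \<sigma> else 0)"

definition boundary_map ::
    "(cell \<Rightarrow> real) \<Rightarrow> cell set \<Rightarrow> cell set \<Rightarrow> (cell \<Rightarrow> real) \<Rightarrow> cell \<Rightarrow> real" where
  "boundary_map \<omega> S T c = (\<lambda>\<sigma>. if \<sigma> \<in> T then \<Sum>\<tau>\<in>S. incidence \<omega> \<sigma> \<tau> * c \<tau> else 0)"

section \<open>Isomorphism of complexes\<close>

definition linear_iso ::
    "('x \<Rightarrow> 'a::real_vector) set \<Rightarrow> ('y \<Rightarrow> 'b::real_vector) set \<Rightarrow> (('x \<Rightarrow> 'a) \<Rightarrow> 'y \<Rightarrow> 'b) \<Rightarrow> bool" where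
  "linear_iso A B \<phi> \<longleftrightarrow> bij_betw \<phi> A B \<and>
     (\<forall>u\<in>A. \<forall>v\<in>A. \<forall>r s. \<phi> (\<lambda>x. r *\<^sub>R u x + s *\<^sub>R v x) = (\<lambda>y. r *\<^sub>R \<phi> u y + s *\<^sub>R \<phi> v y))"

text \<open>
  The relation D is (the graph of) a map from A to B, and \<open>\<phi>\<close>, \<open>\<psi>\<close> carry it to the map d.
\<close>

definition intertwines ::
    "'u set \<Rightarrow> ('u \<Rightarrow> 'v \<Rightarrow> bool) \<Rightarrow> 'v set \<Rightarrow> ('u \<Rightarrow> 'c) \<Rightarrow> ('c \<Rightarrow> 'd) \<Rightarrow> ('v \<Rightarrow> 'd) \<Rightarrow> bool" where
  "intertwines A D B \<phi> d \<psi> \<longleftrightarrow>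
     (\<forall>u\<in>A. \<exists>!v. v \<in> B \<and> D u v) \<and>
     (\<forall>u\<in>A. \<forall>v\<in>B. D u v \<longrightarrow> \<psi> v = d (\<phi> u))"

definition spline_complex_isomorphic ::
    "nat \<Rightarrow> (3 \<Rightarrow> nat) \<Rightarrow> (3 \<Rightarrow> nat \<Rightarrow> real) \<Rightarrow>
     (cell \<Rightarrow> real) set \<Rightarrow> ((cell \<Rightarrow> real) \<Rightarrow> cell \<Rightarrow> real) \<Rightarrow>
     (cell \<Rightarrow> real) set \<Rightarrow> ((cell \<Rightarrow> real) \<Rightarrow> cell \<Rightarrow> real) \<Rightarrow>
     (cell \<Rightarrow> real) set \<Rightarrow> ((cell \<Rightarrow> real) \<Rightarrow> cell \<Rightarrow> real) \<Rightarrow>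
     (cell \<Rightarrow> real) set \<Rightarrow> bool" where
  "spline_complex_isomorphic p n \<xi> A0 d0 A1 d1 A2 d2 A3 \<longleftrightarrow>
     (\<exists>\<phi>0 \<phi>1 \<phi>2 \<phi>3.
        linear_iso (X0h p n \<xi>) A0 \<phi>0 \<and>
        linear_iso (X1h p n \<xi>) A1 \<phi>1 \<and>
        linear_iso (X2h p n \<xi>) A2 \<phi>2 \<and>
        linear_iso (X3h p n \<xi>) A3 \<phi>3 \<and>
        intertwines (X0h p n \<xi>) (grad_on (off_knot_planes p n \<xi>)) (X1h p n \<xi>) \<phi>0 d0 \<phi>1 \<and>
        intertwines (X1h p n \<xi>) (curl_on (off_knot_planes p n \<xi>)) (X2h p n \<xi>) \<phi>1 d1 \<phi>2 \<and>
        intertwines (X2h p n \<xi>) (div_on (off_knot_planes p n \<xi>)) (X3h p n \<xi>) \<phi>2 d2 \<phi>3)"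

definition isomorphic_to_cochain_complex ::
    "nat \<Rightarrow> (3 \<Rightarrow> nat) \<Rightarrow> (3 \<Rightarrow> nat \<Rightarrow> real) \<Rightarrow> (cell \<Rightarrow> real) \<Rightarrow> bool" where
  "isomorphic_to_cochain_complex p n \<xi> \<omega> \<longleftrightarrow>
     (let K = mesh_cells p n in
      spline_complex_isomorphic p n \<xi>
        (functions_on_cells (K 0)) (coboundary \<omega> (K 0) (K 1))
        (functions_on_cells (K 1)) (coboundary \<omega> (K 1) (K 2))
        (functions_on_cells (K 2)) (coboundary \<omega> (K 2) (K 3))
        (functions_on_cells (K 3)))"

text \<open>The chain complex without the boundary; note that elements are never boundary cells.\<close>

definition isomorphic_to_interior_chain_complex ::
    "nat \<Rightarrow> (3 \<Rightarrow> nat) \<Rightarrow> (3 \<Rightarrow> nat \<Rightarrow> real) \<Rightarrow> (cell \<Rightarrow> real) \<Rightarrow> bool" where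
  "isomorphic_to_interior_chain_complex p n \<xi> \<omega> \<longleftrightarrow>
     (let E = mesh_cells p n 3; I = interior_cells p n in
      spline_complex_isomorphic p n \<xi>
        (functions_on_cells E) (boundary_map \<omega> E (I 2))
        (functions_on_cells (I 2)) (boundary_map \<omega> (I 2) (I 1))
        (functions_on_cells (I 1)) (boundary_map \<omega> (I 1) (I 0))
        (functions_on_cells (I 0)))"

end

theory Submission
  imports Defs
begin

text \<open>
  In one direction let \<open>N\<^sub>i\<close> (\<open>1 \<le> i \<le> n\<close>) be the B-splines of degree p, and let
  \<open>M\<^sub>i = p / (\<xi>\<^sub>i\<^sub>+\<^sub>p - \<xi>\<^sub>i) N\<^sub>i\<^sub>,\<^sub>p\<^sub>-\<^sub>1\<close> (\<open>2 \<le> i \<le> n\<close>). These are bases of the two univariate spaces, and away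
  from the knots \<open>N\<^sub>i' = M\<^sub>i - M\<^sub>i\<^sub>+\<^sub>1\<close>, where \<open>M\<^sub>1\<close> and \<open>M\<^sub>n\<^sub>+\<^sub>1\<close> are zero. So in coordinates the derivative
  is the difference operator \<open>c\<^sub>i - c\<^sub>i\<^sub>-\<^sub>1\<close>, that is, the coboundary operator of a path with n
  vertices and n - 1 edges; up to the sign it is also the boundary operator of a path with n edges and
  n - 1 interior vertices. The one-dimensional mesh has n vertices if p is odd, and n edges if p is even.
  Hence \<open>N\<^sub>i\<close> is attached to a vertex and \<open>M\<^sub>i\<close> to an edge for odd p, and the other way round for even p.

  Products of these functions are indexed by the cells of the tensor product mesh. They are bases of the
  spaces of the spline complex, in which gradient, curl and divergence become combinations of the
  three partial differences, and the same is true of the coboundary (boundary) operator. The two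
  complexes can only differ in signs. With e = 1 for odd and e = - 1 for even p, these signs are
  absorbed by rescaling the components of vector fields by (e, 1, e) in \<open>X\<^sup>1\<close> and by (e, - 1, e)
  in \<open>X\<^sup>2\<close>; arbitrary orientations of the cells are absorbed by rescaling the basis functions.

  The analytic ingredients are the derivative formula (\<open>bspline_has_derivative\<close>) and the linear
  independence of the B-splines, which holds even on a single nonempty knot span
  (\<open>bspline_locally_independent\<close>). The multiplicity bound ensures that the support of each \<open>M\<^sub>i\<close>
  contains a nonempty span. Both parities are instances of \<open>complex_isomorphism\<close>.
\<close>

section \<open>B-splines for monotone knots\<close>

lemma bspline_eq_0:
  assumes "mono \<eta>" "\<not> (\<eta> i \<le> t \<and> t < \<eta> (i + q + 1))"
  shows "bspline \<eta> q i t = 0"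
  using assms(2)
proof (induction q arbitrary: i)
  case (Suc q)
  have "\<eta> i \<le> \<eta> (i + 1)" "\<eta> (i + q + 1) \<le> \<eta> (i + q + 2)"
    using assms(1) by (auto intro: monoD)
  then have "bspline \<eta> q i t = 0" "bspline \<eta> q (i + 1) t = 0"
    using Suc.prems by (auto intro!: Suc.IH)
  then show ?case by simp
qed auto

lemma bspline_cong:
  assumes "\<And>k. i \<le> k \<Longrightarrow> k \<le> i + q + 1 \<Longrightarrow> \<eta> k = \<xi> k"
  shows "bspline \<eta> q i t = bspline \<xi> q i t"
  using assms
proof (induction q arbitrary: i)
  case (Suc q)
  have "bspline \<eta> q i t = bspline \<xi> q i t" "bspline \<eta> q (i + 1) t = bspline \<xi> q (i + 1) t"
    by (auto intro!: Suc.IH Suc.prems)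
  moreover have "\<eta> i = \<xi> i" "\<eta> (i + 1) = \<xi> (i + 1)"
    "\<eta> (i + Suc q) = \<xi> (i + Suc q)" "\<eta> (i + Suc q + 1) = \<xi> (i + Suc q + 1)"
    by (auto intro!: Suc.prems)
  ultimately show ?case by simp
qed simp

lemma bspline_trimmed: "bspline (trimmed_knots \<xi>) q i t = bspline \<xi> q (i + 1) t"
  by (induction q arbitrary: i) (auto simp: trimmed_knots_def)

text \<open>Partition of unity: on the span with index m + q only the B-splines m, ..., m + q can be nonzero.\<close>
lemma bspline_sum_eq_1:
  assumes "mono \<eta>" "\<eta> (m + q) \<le> t" "t < \<eta> (m + q + 1)"
  shows "(\<Sum>k\<le>q. bspline \<eta> q (m + k) t) = 1"
  using assms(2,3)
proof (induction q arbitrary: m)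
  case (Suc q)
  define A where "A i = (t - \<eta> i) / (\<eta> (i + Suc q) - \<eta> i) * bspline \<eta> q i t" for i
  define B where "B i = (\<eta> (i + Suc q) - t) / (\<eta> (i + Suc q) - \<eta> i) * bspline \<eta> q i t" for i
  have N: "bspline \<eta> (Suc q) i t = A i + B (Suc i)" for i
    by (simp add: A_def B_def)
  have AB: "A i + B i = bspline \<eta> q i t" for i
  proof (cases "\<eta> (i + Suc q) = \<eta> i")
    case True
    then show ?thesis by (simp add: A_def B_def bspline_eq_0[OF assms(1)])
  next
    case False
    then show ?thesis
      by (simp add: A_def B_def divide_simps) (simp add: algebra_simps)
  qed
  have "A m = 0" "B (Suc (Suc (m + q))) = 0"
    using Suc.prems by (auto simp: A_def B_def bspline_eq_0[OF assms(1)])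
  then have "(\<Sum>k\<le>Suc q. bspline \<eta> (Suc q) (m + k) t) = (\<Sum>k\<le>q. A (Suc m + k) + B (Suc m + k))"
    unfolding N sum.distrib
    by (subst sum.atMost_Suc_shift) (simp add: sum.atMost_Suc)
  also have "\<dots> = 1"
    unfolding AB using Suc.prems by (intro Suc.IH) auto
  finally show ?case .
qed auto

text \<open>
  For q = 0 the truncated index q - 1 is harmless since the factor q vanishes. If a denominator is
  zero, the B-spline it belongs to vanishes as well, so the formula holds for repeated knots too.
\<close>
lemma bspline_has_derivative:
  assumes "mono \<eta>" "t \<notin> range \<eta>"
  shows "(bspline \<eta> q i has_real_derivative
     real q / (\<eta> (i + q) - \<eta> i) * bspline \<eta> (q - 1) i t -
     real q / (\<eta> (i + q + 1) - \<eta> (i + 1)) * bspline \<eta> (q - 1) (i + 1) t) (at t)"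
proof (induction q arbitrary: i)
  case 0
  have "t < \<eta> i \<or> \<eta> i < t \<and> t < \<eta> (i + 1) \<or> \<eta> (i + 1) < t"
    using assms(2) by (metis linorder_neqE rangeI)
  then consider "t \<in> {..<\<eta> i}" | "t \<in> {\<eta> i<..<\<eta> (i + 1)}" | "t \<in> {\<eta> (i + 1)<..}"
    by auto
  then have "(bspline \<eta> 0 i has_real_derivative 0) (at t)"
  proof cases
    case 1
    show ?thesis
      by (rule DERIV_cong[OF has_field_derivative_transform_within_open[of "\<lambda>_. 0", OF _ _ 1]]) auto
  next
    case 2
    show ?thesis
      by (rule DERIV_cong[OF has_field_derivative_transform_within_open[of "\<lambda>_. 1", OF _ _ 2]]) auto
  next
    case 3
    show ?thesis
      by (rule DERIV_cong[OF has_field_derivative_transform_within_open[of "\<lambda>_. 0", OF _ _ 3]]) auto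
  qed
  then show ?case by (simp del: bspline.simps)
next
  case (Suc q)
  define a where "a = \<eta> (i + q) - \<eta> i"
  define b where "b = \<eta> (i + q + 1) - \<eta> (i + 1)"
  define c where "c = \<eta> (i + q + 2) - \<eta> (i + 2)"
  define A where "A = \<eta> (i + q + 1) - \<eta> i"
  define B where "B = \<eta> (i + q + 2) - \<eta> (i + 1)"
  define N where "N k = bspline \<eta> (q - 1) k t" for k
  define d0 where "d0 = real q / a * N i - real q / b * N (i + 1)"
  define d1 where "d1 = real q / b * N (i + 1) - real q / c * N (i + 2)"
  have IH0: "(bspline \<eta> q i has_real_derivative d0) (at t)"
    using Suc.IH[of i] by (simp add: d0_def a_def b_def N_def)
  have IH1: "(bspline \<eta> q (i + 1) has_real_derivative d1) (at t)"
    using Suc.IH[of "i + 1"] by (simp add: d1_def b_def c_def N_def)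
  have D: "(bspline \<eta> (Suc q) i has_real_derivative
      ((1 / A) * bspline \<eta> q i t + (t - \<eta> i) / A * d0) +
      ((- 1 / B) * bspline \<eta> q (i + 1) t + (\<eta> (i + q + 2) - t) / B * d1)) (at t)"
  proof -
    have eq: "bspline \<eta> (Suc q) i = (\<lambda>t. (t - \<eta> i) / A * bspline \<eta> q i t +
        (\<eta> (i + q + 2) - t) / B * bspline \<eta> q (i + 1) t)"
      by (simp add: A_def B_def fun_eq_iff)
    have "((\<lambda>t. (t - \<eta> i) / A) has_real_derivative 1 / A) (at t)"
      "((\<lambda>t. (\<eta> (i + q + 2) - t) / B) has_real_derivative - 1 / B) (at t)"
      by (intro DERIV_cdivide; auto intro!: derivative_eq_intros)+
    then show ?thesis unfolding eq
      by (intro DERIV_cong[OF DERIV_add[OF DERIV_mult[OF _ IH0] DERIV_mult[OF _ IH1]]])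
        (auto simp: mult.commute)
  qed
  have key: "(t - \<eta> i) / A * d0 + (\<eta> (i + q + 2) - t) / B * d1 =
     real q * (bspline \<eta> q i t / A - bspline \<eta> q (i + 1) t / B)"
  proof (cases q)
    case 0
    then show ?thesis by (simp add: d0_def d1_def)
  next
    case (Suc r)
    have N0: "bspline \<eta> q i t = (t - \<eta> i) / a * N i + (\<eta> (i + q + 1) - t) / b * N (i + 1)"
      and N1: "bspline \<eta> q (i + 1) t =
        (t - \<eta> (i + 1)) / b * N (i + 1) + (\<eta> (i + q + 2) - t) / c * N (i + 2)"
      by (auto simp: Suc N_def a_def b_def c_def)
    \<comment> \<open>The coefficients of \<open>N (i + 1)\<close> agree: if b is nonzero, because \<open>A / A = 1 = B / B\<close>;
    otherwise 1 / b = 0.\<close>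
  have mid: "((\<eta> (i + q + 2) - t) / B - (t - \<eta> i) / A) / b =
      ((\<eta> (i + q + 1) - t) / A - (t - \<eta> (i + 1)) / B) / b"
    proof (cases "b = 0")
      case False
      have "\<eta> i \<le> \<eta> (i + 1)" "\<eta> (i + 1) \<le> \<eta> (i + q + 1)" "\<eta> (i + q + 1) \<le> \<eta> (i + q + 2)"
        using assms(1) by (auto intro: monoD)
      then have "A \<noteq> 0" "B \<noteq> 0"
        using False by (auto simp: A_def B_def b_def)
      then have "(\<eta> (i + q + 2) - t) / B + (t - \<eta> (i + 1)) / B =
          (\<eta> (i + q + 1) - t) / A + (t - \<eta> i) / A"
        by (simp add: add_divide_distrib[symmetric] A_def B_def)
      then have "(\<eta> (i + q + 2) - t) / B - (t - \<eta> i) / A =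
          (\<eta> (i + q + 1) - t) / A - (t - \<eta> (i + 1)) / B" by linarith
      then show ?thesis by simp
    qed simp
    have "(t - \<eta> i) / A * d0 + (\<eta> (i + q + 2) - t) / B * d1 =
      real q * ((t - \<eta> i) / A / a * N i
       + ((\<eta> (i + q + 2) - t) / B - (t - \<eta> i) / A) / b * N (i + 1)
       - (\<eta> (i + q + 2) - t) / B / c * N (i + 2))"
      by (simp add: d0_def d1_def divide_inverse algebra_simps)
    also have "\<dots> = real q * (bspline \<eta> q i t / A - bspline \<eta> q (i + 1) t / B)"
      unfolding mid N0 N1 by (simp add: divide_inverse algebra_simps)
    finally show ?thesis .
  qed
  have AB: "\<eta> (i + Suc q) - \<eta> i = A" "\<eta> (i + Suc q + 1) - \<eta> (i + 1) = B"
    by (simp_all add: A_def B_def)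
  show ?case
    unfolding AB
    by (rule DERIV_cong[OF D]) (use key in \<open>simp add: add_divide_distrib algebra_simps\<close>)
qed

text \<open>
  By induction on the degree: differentiating a vanishing combination gives a vanishing combination
  of degree one less on the same span, whence all coefficients are equal; by the partition of unity
  their common value is 0.
\<close>
lemma bspline_locally_independent:
  assumes "mono \<eta>" "\<eta> (m + q) < \<eta> (m + q + 1)"
    and "\<And>t. \<eta> (m + q) < t \<Longrightarrow> t < \<eta> (m + q + 1) \<Longrightarrow> (\<Sum>k\<le>q. c k * bspline \<eta> q (m + k) t) = 0"
  shows "\<forall>k\<le>q. c k = 0"
  using assms(2,3)
proof (induction q arbitrary: m c)
  case 0
  obtain t where "\<eta> m < t" "t < \<eta> (m + 1)" using 0(1) dense[of "\<eta> m" "\<eta> (m + 1)"] by auto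
  then show ?case using 0(2)[of t] by simp
next
  case (Suc q)
  define M where "M i t = real (Suc q) / (\<eta> (i + Suc q) - \<eta> i) * bspline \<eta> q i t" for i t
  have step: "\<forall>k\<le>q. (c (Suc k) - c k) * (real (Suc q) / (\<eta> (Suc m + k + Suc q) - \<eta> (Suc m + k))) = 0"
  proof (rule Suc.IH[where m = "Suc m"])
    show "\<eta> (Suc m + q) < \<eta> (Suc m + q + 1)" using Suc.prems(1) by simp
    fix t assume t: "\<eta> (Suc m + q) < t" "t < \<eta> (Suc m + q + 1)"
    have "t \<notin> range \<eta>"
    proof
      assume "t \<in> range \<eta>"
      then obtain k where "t = \<eta> k" by auto
      moreover have "\<eta> k \<le> \<eta> (Suc m + q) \<or> \<eta> (Suc m + q + 1) \<le> \<eta> k"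
        using assms(1) by (metis Suc_eq_plus1 monoD not_less_eq_eq)
      ultimately show False using t by auto
    qed
    from bspline_has_derivative[OF assms(1) this, of "Suc q"]
    have "((\<lambda>t. \<Sum>k\<le>Suc q. c k * bspline \<eta> (Suc q) (m + k) t) has_real_derivative
       (\<Sum>k\<le>Suc q. c k * (M (m + k) t - M (Suc (m + k)) t))) (at t)"
      by (intro DERIV_sum DERIV_cmult) (simp add: M_def del: bspline.simps)
    moreover have "((\<lambda>t. \<Sum>k\<le>Suc q. c k * bspline \<eta> (Suc q) (m + k) t) has_real_derivative 0) (at t)"
      by (rule has_field_derivative_transform_within_open[of "\<lambda>_. 0" _ _ "{\<eta> (m + Suc q)<..<\<eta> (m + Suc q + 1)}"])
        (use t Suc.prems(2) in auto)
    ultimately have "0 = (\<Sum>k\<le>Suc q. c k * (M (m + k) t - M (Suc (m + k)) t))"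
      using DERIV_unique by blast
    also have "\<dots> = (\<Sum>k\<le>Suc q. c k * M (m + k) t) - (\<Sum>k\<le>Suc q. c k * M (Suc (m + k)) t)"
      by (simp add: right_diff_distrib sum_subtractf)
    also have "\<dots> = (\<Sum>k\<le>q. (c (Suc k) - c k) * M (Suc m + k) t)"
    proof -
      have "M m t = 0" "M (Suc (m + Suc q)) t = 0"
        using t by (auto simp: M_def bspline_eq_0[OF assms(1)])
      moreover have "(\<Sum>k\<le>Suc q. c k * M (m + k) t) = c 0 * M m t + (\<Sum>k\<le>q. c (Suc k) * M (Suc m + k) t)"
        by (subst sum.atMost_Suc_shift) simp
      moreover have "(\<Sum>k\<le>Suc q. c k * M (Suc (m + k)) t) =
         (\<Sum>k\<le>q. c k * M (Suc m + k) t) + c (Suc q) * M (Suc (m + Suc q)) t"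
        by simp
      ultimately show ?thesis by (simp only: left_diff_distrib sum_subtractf)
    qed
    finally show "(\<Sum>k\<le>q. (c (Suc k) - c k) * (real (Suc q) / (\<eta> (Suc m + k + Suc q) - \<eta> (Suc m + k)))
        * bspline \<eta> q (Suc m + k) t) = 0"
      by (simp only: M_def mult.assoc)
  qed
  have eq: "c (Suc k) = c k" if "k \<le> q" for k
  proof -
    have "\<eta> (Suc m + k) \<le> \<eta> (Suc m + q)" "\<eta> (Suc m + q + 1) \<le> \<eta> (Suc m + k + Suc q)"
      using assms(1) that by (auto intro: monoD)
    then have "\<eta> (Suc m + k + Suc q) - \<eta> (Suc m + k) \<noteq> 0" using Suc.prems(1) by auto
    then show ?thesis using step that by auto
  qed
  have const: "c k = c 0" if "k \<le> Suc q" for k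
    using that by (induction k) (auto simp: eq)
  obtain t where t: "\<eta> (m + Suc q) < t" "t < \<eta> (m + Suc q + 1)"
    using Suc.prems(1) dense by blast
  have "0 = (\<Sum>k\<le>Suc q. c k * bspline \<eta> (Suc q) (m + k) t)"
    using Suc.prems(2)[OF t] by simp
  also have "\<dots> = (\<Sum>k\<le>Suc q. c 0 * bspline \<eta> (Suc q) (m + k) t)"
    by (intro sum.cong refl) (metis atMost_iff const)
  also have "\<dots> = c 0 * 1"
    by (subst sum_distrib_left[symmetric], subst bspline_sum_eq_1) (use assms(1) t in auto)
  finally have "c 0 = 0" by simp
  then show ?case using const by metis
qed

text \<open>
  Global independence on the complement of the knots, provided that each index belongs to the
  window of a nonempty span and the whole window lies in the index set.
\<close>
lemma bspline_independent:
  assumes "mono \<eta>" "finite I"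
    and window: "\<And>i. i \<in> I \<Longrightarrow> \<exists>m. m \<le> i \<and> i \<le> m + q \<and> {m..m + q} \<subseteq> I \<and>
          \<eta> (m + q) < \<eta> (m + q + 1)"
    and zero: "\<And>t. t \<in> {\<eta> 0<..<1} - range \<eta> \<Longrightarrow> (\<Sum>i\<in>I. c i * bspline \<eta> q i t) = 0"
    and "\<And>i. \<eta> i \<le> 1"
    and "i \<in> I"
  shows "c i = 0"
proof -
  obtain m where m: "m \<le> i" "i \<le> m + q" "{m..m + q} \<subseteq> I" "\<eta> (m + q) < \<eta> (m + q + 1)"
    using window[OF \<open>i \<in> I\<close>] by auto
  have "\<forall>k\<le>q. c (m + k) = 0"
  proof (rule bspline_locally_independent[OF assms(1) m(4)])
    fix t assume t: "\<eta> (m + q) < t" "t < \<eta> (m + q + 1)"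
    have le: "\<eta> j \<le> \<eta> k" if "j \<le> k" for j k using assms(1) that by (rule monoD)
    have "t \<notin> range \<eta>"
    proof
      assume "t \<in> range \<eta>"
      then obtain k where "t = \<eta> k" by auto
      moreover have "\<eta> k \<le> \<eta> (m + q) \<or> \<eta> (m + q + 1) \<le> \<eta> k"
        by (metis Suc_eq_plus1 le not_less_eq_eq)
      ultimately show False using t by auto
    qed
    moreover have "\<eta> 0 < t" "t < 1"
      using t le[of 0 "m + q"] assms(5)[of "m + q + 1"] by auto
    ultimately have "0 = (\<Sum>i\<in>I. c i * bspline \<eta> q i t)" using zero by simp
    also have "\<dots> = (\<Sum>i\<in>{m..m + q}. c i * bspline \<eta> q i t)"
    proof (rule sum.mono_neutral_right[OF assms(2) m(3)], intro ballI)
      fix i assume "i \<in> I - {m..m + q}"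
      then consider "i + q + 1 \<le> m + q" | "m + q + 1 \<le> i" by fastforce
      then have "\<not> (\<eta> i \<le> t \<and> t < \<eta> (i + q + 1))"
        using t le[of "i + q + 1" "m + q"] le[of "m + q + 1" i] by cases auto
      then show "c i * bspline \<eta> q i t = 0" using bspline_eq_0[OF assms(1)] by simp
    qed
    also have "\<dots> = (\<Sum>k\<le>q. c (m + k) * bspline \<eta> q (m + k) t)"
      by (rule sum.reindex_bij_witness[of _ "\<lambda>k. m + k" "\<lambda>i. i - m"]) auto
    finally show "(\<Sum>k\<le>q. c (m + k) * bspline \<eta> q (m + k) t) = 0" by simp
  qed
  then show ?thesis using m(1,2) by (metis le_add_diff_inverse nat_add_left_cancel_le)
qed

section \<open>Open knot vectors\<close>

text \<open>
  The B-spline of degree p - 1, normalised such that derivatives of B-splines of degree p become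
  differences; it has integral 1 unless its knots coincide.
\<close>
definition M_spline :: "nat \<Rightarrow> (nat \<Rightarrow> real) \<Rightarrow> nat \<Rightarrow> real \<Rightarrow> real" where
  "M_spline p \<xi> i t = real p / (\<xi> (i + p) - \<xi> i) * bspline \<xi> (p - 1) i t"

text \<open>Two parametrised families are equal if each can be reparametrised as the other.\<close>
lemma Collect_ex_reparametrize:
  assumes "\<And>c. P c = Q (h c)" "\<And>d. Q d = P (k d)"
  shows "{s. \<exists>c. s = P c} = {s. \<exists>d. s = Q d}"
  using assms by (intro Collect_cong) metis

locale open_knots =
  fixes p n :: nat and \<xi> :: "nat \<Rightarrow> real"
  assumes p: "1 \<le> p" and open_knots: "open_knot_vector p n \<xi>"
    and multiplicities: "internal_multiplicities_le p p n \<xi>"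
begin

text \<open>
  Only the knots 1, ..., n + p + 1 are constrained. Extending them by constants yields a monotone
  sequence with the same values and the same B-splines.
\<close>
definition \<eta> :: "nat \<Rightarrow> real" where
  "\<eta> i = \<xi> (max 1 (min i (n + p + 1)))"

lemma n: "p + 1 \<le> n" and knots_0: "1 \<le> i \<Longrightarrow> i \<le> p + 1 \<Longrightarrow> \<xi> i = 0"
  and knots_1: "n + 1 \<le> i \<Longrightarrow> i \<le> n + p + 1 \<Longrightarrow> \<xi> i = 1"
  and first_pos: "0 < \<xi> (p + 2)" and last_less: "\<xi> n < 1"
proof -
  note k = open_knots[unfolded open_knot_vector_def]
  show n: "p + 1 \<le> n" using k by blast
  show 0: "\<xi> i = 0" if "1 \<le> i" "i \<le> p + 1" for i using k that by auto
  show 1: "\<xi> i = 1" if "n + 1 \<le> i" "i \<le> n + p + 1" for i using k that by auto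
  show "0 < \<xi> (p + 2)" "\<xi> n < 1" using k 0[of "p + 1"] 1[of "n + 1"] by auto
qed

lemma knots_step:
  assumes "1 \<le> i" "i \<le> n + p"
  shows "\<xi> i \<le> \<xi> (i + 1)"
proof -
  note k = open_knots[unfolded open_knot_vector_def]
  consider "i \<le> p" | "i = p + 1" | "p + 2 \<le> i" "i < n" | "i = n" | "n + 1 \<le> i" using n by linarith
  then show ?thesis
  proof cases
    case 1 then show ?thesis using knots_0[of i] knots_0[of "i + 1"] assms by simp
  next
    case 2 then show ?thesis using knots_0[of i] first_pos p by simp
  next
    case 3 then show ?thesis using k by simp
  next
    case 4 then show ?thesis using knots_1[of "n + 1"] last_less by simp
  next
    case 5 then show ?thesis using knots_1[of i] knots_1[of "i + 1"] assms by simp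
  qed
qed

lemma \<eta>_eq: "1 \<le> i \<Longrightarrow> i \<le> n + p + 1 \<Longrightarrow> \<eta> i = \<xi> i"
  by (simp add: \<eta>_def max_def min_def)

lemma mono_\<eta>: "mono \<eta>"
proof (rule mono_iff_le_Suc[THEN iffD2, rule_format])
  fix i
  consider "i = 0" | "1 \<le> i" "i \<le> n + p" | "n + p + 1 \<le> i" by linarith
  then show "\<eta> i \<le> \<eta> (Suc i)"
  proof cases
    case 2
    then show ?thesis using knots_step[OF 2] \<eta>_eq[of i] \<eta>_eq[of "Suc i"] by simp
  qed (auto simp: \<eta>_def)
qed

lemma \<eta>_0: "i \<le> p + 1 \<Longrightarrow> \<eta> i = 0"
  using knots_0[of "max 1 (min i (n + p + 1))"] by (simp add: \<eta>_def)

lemma \<eta>_1: "n + 1 \<le> i \<Longrightarrow> \<eta> i = 1"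
  using knots_1[of "max 1 (min i (n + p + 1))"] by (simp add: \<eta>_def)

lemma \<eta>_le_1: "\<eta> i \<le> 1"
  using monoD[OF mono_\<eta>, of i "max i (n + 1)"] \<eta>_1[of "max i (n + 1)"] by simp

lemma range_\<eta>: "range \<eta> = \<xi> ` {1..n + p + 1}"
proof (intro equalityI subsetI)
  fix t assume "t \<in> range \<eta>"
  then show "t \<in> \<xi> ` {1..n + p + 1}" by (auto simp: \<eta>_def)
next
  fix t assume "t \<in> \<xi> ` {1..n + p + 1}"
  then obtain i where "i \<in> {1..n + p + 1}" "t = \<xi> i" by auto
  then show "t \<in> range \<eta>" using \<eta>_eq[of i] by (metis atLeastAtMost_iff rangeI)
qed

lemma bspline_\<eta>:
  assumes "1 \<le> i" "i + q \<le> n + p"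
  shows "bspline \<eta> q i = bspline \<xi> q i"
proof
  fix t show "bspline \<eta> q i t = bspline \<xi> q i t"
    using assms by (intro bspline_cong \<eta>_eq) linarith+
qed

text \<open>
  If this failed, p + 1 knots would coincide; they cannot all be 0 or all be 1, and
  internal knots have multiplicity at most p.
\<close>
lemma support_nonempty:
  assumes "2 \<le> i" "i \<le> n"
  shows "\<eta> i < \<eta> (i + p)"
proof (rule ccontr)
  assume "\<not> \<eta> i < \<eta> (i + p)"
  then have eq: "\<eta> j = \<eta> i" if "i \<le> j" "j \<le> i + p" for j
    using monoD[OF mono_\<eta> that(1)] monoD[OF mono_\<eta> that(2)] by linarith
  have "0 < \<eta> (i + p)"
    using monoD[OF mono_\<eta>, of "p + 2" "i + p"] first_pos \<eta>_eq[of "p + 2"] n assms by simp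
  moreover have "\<eta> i < 1"
    using monoD[OF mono_\<eta>, of i n] last_less \<eta>_eq[of n] n assms by simp
  ultimately have "0 < \<eta> i" "\<eta> i < 1" using eq[of "i + p"] by auto
  then have "card {j \<in> {1..n + p + 1}. \<xi> j = \<eta> i} \<le> p"
    using multiplicities by (simp add: internal_multiplicities_le_def)
  moreover have "{i..i + p} \<subseteq> {j \<in> {1..n + p + 1}. \<xi> j = \<eta> i}"
  proof
    fix j assume "j \<in> {i..i + p}"
    then have "j \<in> {1..n + p + 1}" "\<eta> j = \<eta> i" using eq[of j] assms by auto
    then show "j \<in> {j \<in> {1..n + p + 1}. \<xi> j = \<eta> i}" using \<eta>_eq[of j] by simp
  qed
  then have "card {i..i + p} \<le> card {j \<in> {1..n + p + 1}. \<xi> j = \<eta> i}"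
    by (rule card_mono[rotated]) simp
  ultimately show False by simp
qed

text \<open>A nondegenerate interval between knots contains a nonempty span, whose index lies between p + 1 and n.\<close>
lemma span_exists:
  assumes "\<eta> i < \<eta> (i + q)"
  obtains j where "i \<le> j" "j < i + q" "\<eta> j < \<eta> (j + 1)" "p + 1 \<le> j" "j \<le> n"
proof -
  have "\<exists>j. i \<le> j \<and> j < i + q \<and> \<eta> j < \<eta> (j + 1)"
  proof (rule ccontr)
    assume no: "\<not> (\<exists>j. i \<le> j \<and> j < i + q \<and> \<eta> j < \<eta> (j + 1))"
    have "\<eta> (i + k) \<le> \<eta> i" if "k \<le> q" for k
      using that
    proof (induction k)
      case (Suc k)
      have "\<not> \<eta> (i + k) < \<eta> (i + k + 1)"
      proof
        assume "\<eta> (i + k) < \<eta> (i + k + 1)"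
        moreover have "i \<le> i + k" "i + k < i + q" using Suc.prems by simp_all
        ultimately show False using no by blast
      qed
      then show ?case using Suc by simp
    qed simp
    from this[of q] show False using assms by simp
  qed
  then obtain j where j: "i \<le> j" "j < i + q" "\<eta> j < \<eta> (j + 1)" by auto
  moreover have "p + 1 \<le> j" using j(3) \<eta>_0[of j] \<eta>_0[of "j + 1"] by (cases "j \<le> p") auto
  moreover have "j \<le> n" using j(3) \<eta>_1[of j] \<eta>_1[of "j + 1"] by (cases "n + 1 \<le> j") auto
  ultimately show thesis by (rule that)
qed

text \<open>The points of the open unit interval that are not knots.\<close>
definition off_knots :: "real set" where
  "off_knots = {0<..<1} - \<xi> ` {1..n + p + 1}"

lemma off_knots_\<eta>: "off_knots = {\<eta> 0<..<1} - range \<eta>"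
  by (simp add: off_knots_def range_\<eta> \<eta>_0)

lemma M_spline_coeff:
  assumes "2 \<le> i" "i \<le> n"
  shows "real p / (\<xi> (i + p) - \<xi> i) \<noteq> 0"
  using support_nonempty[OF assms] \<eta>_eq[of i] \<eta>_eq[of "i + p"] assms p by simp

text \<open>The boundary terms \<open>M\<^sub>1\<close> and \<open>M\<^sub>n\<^sub>+\<^sub>1\<close> vanish because the p + 1 outermost knots coincide.\<close>
lemma bspline_deriv_eq_diff:
  assumes i: "1 \<le> i" "i \<le> n" and t: "t \<in> off_knots"
  shows "(bspline \<xi> p i has_real_derivative
     (if 2 \<le> i then M_spline p \<xi> i t else 0) - (if i + 1 \<le> n then M_spline p \<xi> (i + 1) t else 0)) (at t)"
proof -
  have "M_spline p \<xi> i t = 0" if "\<not> 2 \<le> i"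
  proof -
    have "i = 1" using that i by simp
    then show ?thesis using knots_0[of 1] knots_0[of "1 + p"] by (simp add: M_spline_def)
  qed
  moreover have "M_spline p \<xi> (i + 1) t = 0" if "\<not> i + 1 \<le> n"
  proof -
    have "i = n" using that i by simp
    then show ?thesis using knots_1[of "n + 1"] knots_1[of "n + 1 + p"] by (simp add: M_spline_def)
  qed
  moreover have "(bspline \<xi> p i has_real_derivative M_spline p \<xi> i t - M_spline p \<xi> (i + 1) t) (at t)"
    using bspline_has_derivative[OF mono_\<eta>, of t p i] t i p
    by (simp add: off_knots_\<eta> bspline_\<eta> \<eta>_eq M_spline_def add_ac)
  ultimately show ?thesis by (auto split: if_splits)
qed

lemma M_spline_deriv:
  assumes i: "2 \<le> i" "i \<le> n" and t: "t \<in> off_knots"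
  shows "\<exists>D. (M_spline p \<xi> i has_real_derivative D) (at t)"
proof -
  have "bspline \<eta> (p - 1) i = bspline \<xi> (p - 1) i" using i p by (intro bspline_\<eta>) auto
  then obtain D where "(bspline \<xi> (p - 1) i has_real_derivative D) (at t)"
    using bspline_has_derivative[OF mono_\<eta>, of t "p - 1" i] t by (auto simp: off_knots_\<eta>)
  from DERIV_cmult[OF this, of "real p / (\<xi> (i + p) - \<xi> i)"] show ?thesis
    unfolding M_spline_def[abs_def] by blast
qed

lemma bspline_basis_independent:
  assumes "\<And>t. t \<in> off_knots \<Longrightarrow> (\<Sum>i=1..n. c i * bspline \<xi> p i t) = 0" "i \<in> {1..n}"
  shows "c i = 0"
proof (rule bspline_independent[OF mono_\<eta> _ _ _ \<eta>_le_1 assms(2)])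
  fix t assume "t \<in> {\<eta> 0<..<1} - range \<eta>"
  then have "(\<Sum>i=1..n. c i * bspline \<xi> p i t) = 0" using assms(1) by (simp add: off_knots_\<eta>)
  then show "(\<Sum>i=1..n. c i * bspline \<eta> p i t) = 0" by (simp add: bspline_\<eta>)
next
  fix i assume i: "i \<in> {1..n}"
  have "\<eta> i < \<eta> (i + (p + 1))"
  proof (cases "i = 1")
    case True
    then show ?thesis using first_pos \<eta>_0[of 1] \<eta>_eq[of "p + 2"] n by (simp add: add_ac)
  next
    case False
    then have "\<eta> i < \<eta> (i + p)" using i by (intro support_nonempty) auto
    also have "\<dots> \<le> \<eta> (i + (p + 1))" by (rule monoD[OF mono_\<eta>]) simp
    finally show ?thesis .
  qed
  then obtain j where j: "i \<le> j" "j < i + (p + 1)" "\<eta> j < \<eta> (j + 1)" "p + 1 \<le> j" "j \<le> n"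
    by (rule span_exists)
  then show "\<exists>m\<le>i. i \<le> m + p \<and> {m..m + p} \<subseteq> {1..n} \<and> \<eta> (m + p) < \<eta> (m + p + 1)"
    by (intro exI[of _ "j - p"]) auto
qed simp

lemma M_spline_independent:
  assumes "\<And>t. t \<in> off_knots \<Longrightarrow> (\<Sum>i=2..n. c i * M_spline p \<xi> i t) = 0" "i \<in> {2..n}"
  shows "c i = 0"
proof -
  have "c i * (real p / (\<xi> (i + p) - \<xi> i)) = 0"
  proof (rule bspline_independent[OF mono_\<eta> _ _ _ \<eta>_le_1 assms(2), of "p - 1"])
    fix t assume "t \<in> {\<eta> 0<..<1} - range \<eta>"
    then have "(\<Sum>i=2..n. c i * M_spline p \<xi> i t) = 0" using assms(1) by (simp add: off_knots_\<eta>)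
    moreover have "bspline \<eta> (p - 1) i = bspline \<xi> (p - 1) i" if "i \<in> {2..n}" for i
      using that p by (intro bspline_\<eta>) auto
    ultimately show "(\<Sum>i=2..n. c i * (real p / (\<xi> (i + p) - \<xi> i)) * bspline \<eta> (p - 1) i t) = 0"
      by (simp add: M_spline_def mult.assoc)
  next
    fix i assume i: "i \<in> {2..n}"
    then have "\<eta> i < \<eta> (i + p)" using support_nonempty by simp
    then obtain j where j: "i \<le> j" "j < i + p" "\<eta> j < \<eta> (j + 1)" "p + 1 \<le> j" "j \<le> n"
      by (rule span_exists)
    then show "\<exists>m\<le>i. i \<le> m + (p - 1) \<and> {m..m + (p - 1)} \<subseteq> {2..n} \<and>
        \<eta> (m + (p - 1)) < \<eta> (m + (p - 1) + 1)"
      using p by (intro exI[of _ "j + 1 - p"]) auto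
  qed simp
  then show ?thesis using M_spline_coeff[of i] assms(2) by auto
qed

lemma trimmed_spline_space_eq:
  "trimmed_spline_space p n \<xi> = {s. \<exists>c. s = (\<lambda>t. \<Sum>i=2..n. c i * M_spline p \<xi> i t)}"
proof -
  have shift: "(\<Sum>i=1..n - 1. c i * bspline (trimmed_knots \<xi>) (p - 1) i t) =
      (\<Sum>i=2..n. c (i - 1) * bspline \<xi> (p - 1) i t)" for c t
    by (rule sum.reindex_bij_witness[of _ "\<lambda>i. i - 1" "\<lambda>i. i + 1"]) (auto simp: bspline_trimmed)
  let ?h = "\<lambda>i. real p / (\<xi> (i + p) - \<xi> i)"
  have cancel: "a / h * (h * b) = a * b" if "h \<noteq> 0" for a b h :: real using that by simp
  show ?thesis
    unfolding trimmed_spline_space_def spline_space_def shift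
  proof (rule Collect_ex_reparametrize[where h = "\<lambda>c i. c (i - 1) / ?h i" and k = "\<lambda>d i. d (i + 1) * ?h (i + 1)"])
    fix c
    show "(\<lambda>t. \<Sum>i=2..n. c (i - 1) * bspline \<xi> (p - 1) i t) =
        (\<lambda>t. \<Sum>i=2..n. c (i - 1) / ?h i * M_spline p \<xi> i t)"
    proof (intro ext sum.cong refl)
      fix t i assume "i \<in> {2..n}"
      then have "?h i \<noteq> 0" by (intro M_spline_coeff) auto
      then show "c (i - 1) * bspline \<xi> (p - 1) i t = c (i - 1) / ?h i * M_spline p \<xi> i t"
        unfolding M_spline_def by (rule cancel[symmetric])
    qed
  next
    fix d
    show "(\<lambda>t. \<Sum>i=2..n. d i * M_spline p \<xi> i t) =
        (\<lambda>t. \<Sum>i=2..n. d (i - 1 + 1) * ?h (i - 1 + 1) * bspline \<xi> (p - 1) i t)"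
    proof (intro ext sum.cong refl)
      fix t i assume "i \<in> {2..n}"
      then have "i - 1 + 1 = i" by simp
      then show "d i * M_spline p \<xi> i t = d (i - 1 + 1) * ?h (i - 1 + 1) * bspline \<xi> (p - 1) i t"
        by (simp only: M_spline_def mult.assoc)
    qed
  qed
qed

end

text \<open>
  The two bases are labelled by cells: \<open>f i\<close> carries the i-th B-spline of degree p and \<open>g i\<close> the
  i-th M-spline. Up to the sign e, the matrix J of incidence numbers represents the derivative.
\<close>
locale labelled_splines = open_knots +
  fixes f g :: "nat \<Rightarrow> cell1" and \<beta> :: "cell1 \<Rightarrow> real \<Rightarrow> real"
    and J :: "cell1 \<Rightarrow> cell1 \<Rightarrow> real" and e :: real
  assumes inj_f: "inj_on f {1..n}" and inj_g: "inj_on g {2..n}"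
    and \<beta>_f: "i \<in> {1..n} \<Longrightarrow> \<beta> (f i) = bspline \<xi> p i"
    and \<beta>_g: "i \<in> {2..n} \<Longrightarrow> \<beta> (g i) = M_spline p \<xi> i"
    and J_fg: "i \<in> {1..n} \<Longrightarrow> k \<in> {2..n} \<Longrightarrow>
      e * J (f i) (g k) = (if k = i then 1 else 0) - (if k = i + 1 then 1 else 0)"
begin

lemma sum_f: "(\<Sum>a\<in>f ` {1..n}. c a * \<beta> a t) = (\<Sum>i=1..n. c (f i) * bspline \<xi> p i t)"
  by (simp add: sum.reindex[OF inj_f] \<beta>_f del: One_nat_def)

lemma sum_g: "(\<Sum>b\<in>g ` {2..n}. c b * \<beta> b t) = (\<Sum>i=2..n. c (g i) * M_spline p \<xi> i t)"
  by (simp add: sum.reindex[OF inj_g] \<beta>_g)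

lemma spline_space_f: "spline_space p n \<xi> = {s. \<exists>c. s = (\<lambda>t. \<Sum>a\<in>f ` {1..n}. c a * \<beta> a t)}"
  unfolding spline_space_def sum_f
  by (rule Collect_ex_reparametrize[where h = "\<lambda>c a. c (inv_into {1..n} f a)" and k = "\<lambda>c i. c (f i)"])
    (simp_all only: inv_into_f_f[OF inj_f] cong: sum.cong)

lemma trimmed_spline_space_g:
  "trimmed_spline_space p n \<xi> = {s. \<exists>c. s = (\<lambda>t. \<Sum>b\<in>g ` {2..n}. c b * \<beta> b t)}"
  unfolding trimmed_spline_space_eq sum_g
  by (rule Collect_ex_reparametrize[where h = "\<lambda>c b. c (inv_into {2..n} g b)" and k = "\<lambda>c i. c (g i)"])
    (simp_all only: inv_into_f_f[OF inj_g] cong: sum.cong)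

lemma deriv_f:
  assumes "a \<in> f ` {1..n}" "t \<in> off_knots"
  shows "(\<beta> a has_real_derivative e * (\<Sum>b\<in>g ` {2..n}. J a b * \<beta> b t)) (at t)"
proof -
  obtain i where i: "i \<in> {1..n}" "a = f i" using assms by auto
  have "e * (\<Sum>b\<in>g ` {2..n}. J a b * \<beta> b t) = (\<Sum>k=2..n. e * J (f i) (g k) * M_spline p \<xi> k t)"
    unfolding sum_g sum_distrib_left i by (simp add: mult.assoc)
  also have "\<dots> = (\<Sum>k=2..n. (if k = i then M_spline p \<xi> k t else 0) - (if k = i + 1 then M_spline p \<xi> k t else 0))"
    using i by (intro sum.cong refl) (simp add: J_fg)
  also have "\<dots> = (if 2 \<le> i then M_spline p \<xi> i t else 0) - (if i + 1 \<le> n then M_spline p \<xi> (i + 1) t else 0)"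
    using i by (simp add: sum_subtractf)
  finally show ?thesis using bspline_deriv_eq_diff[of i t] i assms(2) by (simp add: \<beta>_f)
qed

lemma deriv_g: "b \<in> g ` {2..n} \<Longrightarrow> t \<in> off_knots \<Longrightarrow> \<exists>D. (\<beta> b has_real_derivative D) (at t)"
  using M_spline_deriv by (auto simp: \<beta>_g)

lemma indep_f:
  assumes "\<And>t. t \<in> off_knots \<Longrightarrow> (\<Sum>a\<in>f ` {1..n}. c a * \<beta> a t) = 0" "a \<in> f ` {1..n}"
  shows "c a = 0"
proof -
  obtain i where i: "i \<in> {1..n}" "a = f i" using assms(2) by blast
  have "(\<lambda>i. c (f i)) i = 0"
    by (rule bspline_basis_independent[OF _ i(1)]) (use assms(1) in \<open>simp only: sum_f\<close>)
  then show ?thesis using i by simp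
qed

lemma indep_g:
  assumes "\<And>t. t \<in> off_knots \<Longrightarrow> (\<Sum>b\<in>g ` {2..n}. c b * \<beta> b t) = 0" "b \<in> g ` {2..n}"
  shows "c b = 0"
proof -
  obtain i where i: "i \<in> {2..n}" "b = g i" using assms(2) by blast
  have "(\<lambda>i. c (g i)) i = 0"
    by (rule M_spline_independent[OF _ i(1)]) (use assms(1) in \<open>simp only: sum_g\<close>)
  then show ?thesis using i by simp
qed

end

section \<open>Tensor products on the unit cube\<close>

text \<open>Product cells whose l-th factor lies in \<open>A l\<close>.\<close>
definition cell_box :: "(3 \<Rightarrow> cell1 set) \<Rightarrow> cell set" where
  "cell_box A = A 1 \<times> A 2 \<times> A 3"

text \<open>The product basis function attached to a product cell.\<close>
fun tensor_fun :: "(3 \<Rightarrow> cell1 \<Rightarrow> real \<Rightarrow> real) \<Rightarrow> cell \<Rightarrow> real^3 \<Rightarrow> real" where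
  "tensor_fun \<beta> (a, b, c) x = \<beta> 1 a (x $ 1) * \<beta> 2 b (x $ 2) * \<beta> 3 c (x $ 3)"

text \<open>Linear combinations of the product basis functions, extended by zero as in the tensor product spaces.\<close>
definition tensor_sum ::
    "(3 \<Rightarrow> cell1 \<Rightarrow> real \<Rightarrow> real) \<Rightarrow> (3 \<Rightarrow> cell1 set) \<Rightarrow> (cell \<Rightarrow> real) \<Rightarrow> real^3 \<Rightarrow> real" where
  "tensor_sum \<beta> A c = (\<lambda>x. if x \<in> unit_cube then \<Sum>\<sigma>\<in>cell_box A. c \<sigma> * tensor_fun \<beta> \<sigma> x else 0)"

lemma finite_cell_box: "(\<And>l. finite (A l)) \<Longrightarrow> finite (cell_box A)"
  by (simp add: cell_box_def)

lemma tensor_sum_linear: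
  "tensor_sum \<beta> A (\<lambda>\<sigma>. r * c \<sigma> + s * d \<sigma>) x = r * tensor_sum \<beta> A c x + s * tensor_sum \<beta> A d x"
  by (simp add: tensor_sum_def sum_distrib_left sum.distrib distrib_right mult.assoc)

lemma tensor_sum_cong:
  "(\<And>\<sigma>. \<sigma> \<in> cell_box A \<Longrightarrow> c \<sigma> = d \<sigma>) \<Longrightarrow> tensor_sum \<beta> A c = tensor_sum \<beta> A d"
  by (auto simp: tensor_sum_def intro!: ext sum.cong)

lemma tensor_sum_scale: "tensor_sum \<beta> A (\<lambda>\<sigma>. r * c \<sigma>) x = r * tensor_sum \<beta> A c x"
  using tensor_sum_linear[of \<beta> A r c 0 c x] by simp

lemma tensor_sum_nested:
  "x \<in> unit_cube \<Longrightarrow> tensor_sum \<beta> A c x = (\<Sum>a1\<in>A 1. \<Sum>a2\<in>A 2. \<Sum>a3\<in>A 3.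
     c (a1, a2, a3) * (\<beta> 1 a1 (x $ 1) * \<beta> 2 a2 (x $ 2) * \<beta> 3 a3 (x $ 3)))"
  by (auto simp: tensor_sum_def cell_box_def sum.cartesian_product intro!: sum.cong)

lemma prod_UNIV_3: "(\<Prod>l\<in>(UNIV :: 3 set). f l) = f 1 * f 2 * f 3"
  unfolding UNIV_3 by (simp add: ac_simps)

text \<open>The tensor product of the spans of univariate families is the span of the product functions.\<close>
lemma tensor_space_eq_range:
  fixes A :: "3 \<Rightarrow> cell1 set"
  assumes fin: "\<And>l. finite (A l)"
    and V: "\<And>l. V l = {s. \<exists>c. s = (\<lambda>t. \<Sum>a\<in>A l. c a * \<beta> l a t)}"
  shows "tensor_space V = range (tensor_sum \<beta> A)"
proof (intro equalityI subsetI)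
  fix u assume "u \<in> tensor_space V"
  then obtain m :: nat and f where f: "\<And>j l. j < m \<Longrightarrow> f j l \<in> V l"
    and u: "u = (\<lambda>x. if x \<in> unit_cube then \<Sum>j<m. \<Prod>l\<in>UNIV. f j l (x $ l) else 0)"
    unfolding tensor_space_def by blast
  have "\<exists>c. f j l = (\<lambda>t. \<Sum>a\<in>A l. c a * \<beta> l a t)" if "j < m" for j l
    using f[OF that, of l] V by auto
  then obtain g where g: "\<And>j l. j < m \<Longrightarrow> f j l = (\<lambda>t. \<Sum>a\<in>A l. g j l a * \<beta> l a t)" by metis
  define c where "c = (\<lambda>(a1, a2, a3). \<Sum>j<m. g j 1 a1 * g j 2 a2 * g j 3 a3)"
  have "u x = tensor_sum \<beta> A c x" for x
  proof (cases "x \<in> unit_cube")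
    case True
    have triple: "sum f1 (A 1) * (sum f2 (A 2) * sum f3 (A 3)) =
        (\<Sum>a1\<in>A 1. \<Sum>a2\<in>A 2. \<Sum>a3\<in>A 3. f1 a1 * (f2 a2 * f3 a3))" for f1 f2 f3 :: "cell1 \<Rightarrow> real"
      by (simp only: sum_product) (simp only: sum_distrib_left)
    have "u x = (\<Sum>j<m. (\<Sum>a\<in>A 1. g j 1 a * \<beta> 1 a (x $ 1)) * ((\<Sum>a\<in>A 2. g j 2 a * \<beta> 2 a (x $ 2)) *
       (\<Sum>a\<in>A 3. g j 3 a * \<beta> 3 a (x $ 3))))"
    proof -
      have "(\<Prod>l\<in>UNIV. f j l (x $ l)) = f j 1 (x $ 1) * (f j 2 (x $ 2) * f j 3 (x $ 3))" for j
        by (simp add: prod_UNIV_3 mult.assoc)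
      then have "u x = (\<Sum>j<m. f j 1 (x $ 1) * (f j 2 (x $ 2) * f j 3 (x $ 3)))"
        using True by (simp only: u if_True)
      also have "\<dots> = (\<Sum>j<m. (\<Sum>a\<in>A 1. g j 1 a * \<beta> 1 a (x $ 1)) *
          ((\<Sum>a\<in>A 2. g j 2 a * \<beta> 2 a (x $ 2)) * (\<Sum>a\<in>A 3. g j 3 a * \<beta> 3 a (x $ 3))))"
        by (intro sum.cong refl) (simp only: g lessThan_iff)
      finally show ?thesis .
    qed
    also have "\<dots> = (\<Sum>j<m. \<Sum>a1\<in>A 1. \<Sum>a2\<in>A 2. \<Sum>a3\<in>A 3.
       g j 1 a1 * g j 2 a2 * g j 3 a3 * (\<beta> 1 a1 (x $ 1) * \<beta> 2 a2 (x $ 2) * \<beta> 3 a3 (x $ 3)))"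
      unfolding triple by (intro sum.cong refl) (simp only: mult_ac)
    also have "\<dots> = (\<Sum>a1\<in>A 1. \<Sum>a2\<in>A 2. \<Sum>a3\<in>A 3. \<Sum>j<m.
       g j 1 a1 * g j 2 a2 * g j 3 a3 * (\<beta> 1 a1 (x $ 1) * \<beta> 2 a2 (x $ 2) * \<beta> 3 a3 (x $ 3)))"
      by (rule trans[OF sum.swap], rule sum.cong[OF refl], rule trans[OF sum.swap],
          rule sum.cong[OF refl], rule sum.swap)
    also have "\<dots> = tensor_sum \<beta> A c x"
      using True by (simp add: tensor_sum_nested c_def sum_distrib_right)
    finally show ?thesis .
  qed (simp add: u tensor_sum_def)
  then show "u \<in> range (tensor_sum \<beta> A)" by auto
next
  fix u assume "u \<in> range (tensor_sum \<beta> A)"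
  then obtain c where u: "u = tensor_sum \<beta> A c" by auto
  \<comment> \<open>The cells are enumerated to obtain a sum over \<open>j < m\<close>; the coefficient goes into the first factor.\<close>
  obtain h where h: "bij_betw h {..<card (cell_box A)} (cell_box A)"
    using ex_bij_betw_nat_finite[OF finite_cell_box[of A]] fin by (auto simp: atLeast0LessThan)
  define f where "f j l = (case h j of (a1, a2, a3) \<Rightarrow>
     if l = 1 then (\<lambda>t. c (h j) * \<beta> 1 a1 t) else if l = 2 then \<beta> 2 a2 else \<beta> 3 a3)" for j and l :: 3
  have mem: "(\<lambda>t. r * \<beta> l a t) \<in> V l" if "a \<in> A l" for a l and r :: real
  proof -
    have "(\<Sum>b\<in>A l. (if b = a then r else 0) * \<beta> l b t) = (\<Sum>b\<in>A l. if b = a then r * \<beta> l b t else 0)" for t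
      by (intro sum.cong) auto
    then have "(\<lambda>t. r * \<beta> l a t) = (\<lambda>t. \<Sum>b\<in>A l. (if b = a then r else 0) * \<beta> l b t)"
      using that fin by simp
    then show ?thesis unfolding V by (intro CollectI exI[of _ "\<lambda>b. if b = a then r else 0"])
  qed
  have "f j l \<in> V l" if "j < card (cell_box A)" for j l
  proof -
    have "h j \<in> cell_box A" using h that by (auto simp: bij_betw_def)
    then obtain a1 a2 a3 where "h j = (a1, a2, a3)" "a1 \<in> A 1" "a2 \<in> A 2" "a3 \<in> A 3"
      by (auto simp: cell_box_def)
    then show ?thesis
      using exhaust_3[of l] mem[of a1 1 "c (h j)"] mem[of a2 2 1] mem[of a3 3 1] by (auto simp: f_def)
  qed
  moreover have "u = (\<lambda>x. if x \<in> unit_cube then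
      \<Sum>j<card (cell_box A). \<Prod>l\<in>UNIV. f j l (x $ l) else 0)"
  proof -
    have "(\<Sum>\<sigma>\<in>cell_box A. c \<sigma> * tensor_fun \<beta> \<sigma> x) =
        (\<Sum>j<card (cell_box A). c (h j) * tensor_fun \<beta> (h j) x)" for x
      by (rule sum.reindex_bij_betw[OF h, symmetric])
    moreover have "c (h j) * tensor_fun \<beta> (h j) x = (\<Prod>l\<in>UNIV. f j l (x $ l))" for j x
      by (cases "h j") (simp add: f_def prod_UNIV_3)
    ultimately show ?thesis by (auto simp: u tensor_sum_def fun_eq_iff)
  qed
  ultimately show "u \<in> tensor_space V" unfolding tensor_space_def by blast
qed

lemma tensor_fun_has_derivative:
  assumes "(\<beta> 1 a has_real_derivative deriv (\<beta> 1 a) (x $ 1)) (at (x $ 1))"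
    "(\<beta> 2 b has_real_derivative deriv (\<beta> 2 b) (x $ 2)) (at (x $ 2))"
    "(\<beta> 3 c has_real_derivative deriv (\<beta> 3 c) (x $ 3)) (at (x $ 3))"
  shows "(tensor_fun \<beta> (a, b, c) has_derivative
     (\<lambda>h. \<Sum>k\<in>UNIV. h $ k * tensor_fun (\<beta>(k := \<lambda>a. deriv (\<beta> k a))) (a, b, c) x)) (at x)"
proof -
  have coord: "((\<lambda>x. f (x $ l)) has_derivative (\<lambda>h. h $ l * D)) (at x)"
    if "(f has_real_derivative D) (at (x $ l))" for f :: "real \<Rightarrow> real" and D and l :: 3
  proof -
    have "((\<lambda>x. x $ l) has_derivative (\<lambda>h. h $ l)) (at x)"
      by (rule bounded_linear_imp_has_derivative[OF bounded_linear_vec_nth])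
    from has_derivative_compose[OF this] that show ?thesis
      by (fastforce simp: has_field_derivative_def mult.commute)
  qed
  note d = assms[THEN coord]
  have eq: "tensor_fun \<beta> (a, b, c) = (\<lambda>x. \<beta> 1 a (x $ 1) * \<beta> 2 b (x $ 2) * \<beta> 3 c (x $ 3))"
    by (simp add: fun_eq_iff)
  show ?thesis
    unfolding eq
    by (rule has_derivative_eq_rhs[OF has_derivative_mult[OF has_derivative_mult[OF d(1,2)] d(3)]])
      (simp add: fun_eq_iff sum_3 algebra_simps)
qed

lemma open_unit_cube: "open unit_cube"
proof -
  have "unit_cube = (\<Inter>l. {x. 0 < x $ l} \<inter> {x. x $ l < 1})" by (auto simp: unit_cube_def)
  also have "open \<dots>"
    by (auto intro!: open_INT open_Int open_Collect_less continuous_intros)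
  finally show ?thesis .
qed

lemma ex_3: "(\<exists>k::3. P k) \<longleftrightarrow> P 1 \<or> P 2 \<or> P 3"
  using exhaust_3 by metis

lemma jacobian_eqI:
  fixes u :: "real^3 \<Rightarrow> real^3"
  assumes "\<And>k. ((\<lambda>x. u x $ k) has_derivative (\<lambda>h. \<Sum>j\<in>UNIV. h $ j * p k j)) (at x)"
  shows "u differentiable (at x)" "jacobian u (at x) $ k $ j = p k j"
proof -
  have "(u has_derivative (\<lambda>h. \<chi> k. \<Sum>j\<in>UNIV. h $ j * p k j)) (at x)"
    unfolding has_derivative_componentwise_within[of u]
    using assms by (auto simp: Basis_vec_def inner_axis)
  then show "u differentiable (at x)"
    and "jacobian u (at x) $ k $ j = p k j"
    unfolding differentiable_def jacobian_def matrix_def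
    by (auto simp: frechet_derivative_at[symmetric] axis_def if_distrib[of "\<lambda>z. z * _"] cong: if_cong)
qed

section \<open>Isomorphisms of complexes given by inverse maps\<close>

lemma functions_on_cells_eqI:
  assumes "c \<in> functions_on_cells S" "d \<in> functions_on_cells S" "\<And>\<sigma>. \<sigma> \<in> S \<Longrightarrow> c \<sigma> = d \<sigma>"
  shows "c = d"
proof
  fix \<sigma>
  have "c \<sigma> = 0 \<and> d \<sigma> = 0" if "\<sigma> \<notin> S"
    using assms(1,2) that unfolding functions_on_cells_def by blast
  then show "c \<sigma> = d \<sigma>" using assms(3) by (cases "\<sigma> \<in> S") simp_all
qed

text \<open>
  It is convenient to construct the inverse isomorphisms \<open>\<Psi>\<close>, from cochains to functions.
  The image of a function under R then exists by construction, and only its uniqueness must be shown.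
\<close>
lemma intertwines_inv_into:
  assumes "bij_betw \<Psi> C A" "bij_betw \<Psi>' C' B"
    and "\<And>c. c \<in> C \<Longrightarrow> d c \<in> C' \<and> R (\<Psi> c) (\<Psi>' (d c))"
    and uniq: "\<And>u v v'. v \<in> B \<Longrightarrow> v' \<in> B \<Longrightarrow> R u v \<Longrightarrow> R u v' \<Longrightarrow> v = v'"
  shows "intertwines A R B (inv_into C \<Psi>) d (inv_into C' \<Psi>')"
  unfolding intertwines_def
proof (intro conjI ballI impI)
  have ex: "\<Psi>' (d (inv_into C \<Psi> u)) \<in> B \<and> R u (\<Psi>' (d (inv_into C \<Psi> u))) \<and> d (inv_into C \<Psi> u) \<in> C'"
    if "u \<in> A" for u
  proof -
    have "inv_into C \<Psi> u \<in> C" "\<Psi> (inv_into C \<Psi> u) = u"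
      using that assms(1) by (auto simp: bij_betw_def inv_into_into f_inv_into_f)
    then show ?thesis using assms(3)[of "inv_into C \<Psi> u"] assms(2) by (auto simp: bij_betw_def)
  qed
  fix u assume u: "u \<in> A"
  show "\<exists>!v. v \<in> B \<and> R u v" using ex[OF u] uniq by blast
  fix v assume "v \<in> B" "R u v"
  then have "v = \<Psi>' (d (inv_into C \<Psi> u))" using ex[OF u] uniq by blast
  then show "inv_into C' \<Psi>' v = d (inv_into C \<Psi> u)"
    using ex[OF u] assms(2) by (simp add: bij_betw_def inv_into_f_f)
qed

lemma linear_iso_inv_into:
  fixes \<Psi> :: "(cell \<Rightarrow> real) \<Rightarrow> 'x \<Rightarrow> 'b::real_vector"
  assumes bij: "bij_betw \<Psi> (functions_on_cells S) A"
    and lin: "\<And>c d r s. \<Psi> (\<lambda>\<sigma>. r * c \<sigma> + s * d \<sigma>) = (\<lambda>x. r *\<^sub>R \<Psi> c x + s *\<^sub>R \<Psi> d x)"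
  shows "linear_iso A (functions_on_cells S) (inv_into (functions_on_cells S) \<Psi>)"
  unfolding linear_iso_def
proof (intro conjI ballI allI)
  let ?C = "functions_on_cells S" let ?\<phi> = "inv_into ?C \<Psi>"
  show "bij_betw ?\<phi> A ?C" using bij by (rule bij_betw_inv_into)
  fix u v and r s :: real assume "u \<in> A" "v \<in> A"
  then have u: "?\<phi> u \<in> ?C" "\<Psi> (?\<phi> u) = u" and v: "?\<phi> v \<in> ?C" "\<Psi> (?\<phi> v) = v"
    using bij by (auto simp: bij_betw_def inv_into_into f_inv_into_f)
  let ?w = "\<lambda>\<sigma>. r * ?\<phi> u \<sigma> + s * ?\<phi> v \<sigma>"
  have "?w \<in> ?C" using u v by (simp add: functions_on_cells_def)
  moreover have "\<Psi> ?w = (\<lambda>x. r *\<^sub>R u x + s *\<^sub>R v x)" using u v lin by simp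
  ultimately show "?\<phi> (\<lambda>x. r *\<^sub>R u x + s *\<^sub>R v x) = (\<lambda>y. r *\<^sub>R ?\<phi> u y + s *\<^sub>R ?\<phi> v y)"
    using bij inv_into_f_f[of \<Psi> ?C ?w] by (simp add: bij_betw_def)
qed

section \<open>Incidence of product cells\<close>

text \<open>
  The product incidence numbers built from an arbitrary univariate incidence matrix J. They give the
  coboundary operator for \<open>J = incidence1\<close>, and the boundary operator for its transpose: the factors of the two
  cells that enter the signs are equal, so it does not matter which cell they are taken from.
\<close>
fun cell_incidence :: "(cell1 \<Rightarrow> cell1 \<Rightarrow> real) \<Rightarrow> cell \<Rightarrow> cell \<Rightarrow> real" where
  "cell_incidence J (a', b', c') (a, b, c) =
     (if b' = b \<and> c' = c then J a' a else 0) +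
     (if a' = a \<and> c' = c then (- 1) ^ dim1 a * J b' b else 0) +
     (if a' = a \<and> b' = b then (- 1) ^ (dim1 a + dim1 b) * J c' c else 0)"

text \<open>Only the cells that differ from a given cell in a single factor contribute.\<close>
lemma sum_cell_incidence:
  assumes "finite S"
  shows "(\<Sum>\<sigma>\<in>S. cell_incidence J \<sigma> (a, b, c) * f \<sigma>) =
     (\<Sum>a'\<in>{a'. (a', b, c) \<in> S}. J a' a * f (a', b, c)) +
     (- 1) ^ dim1 a * (\<Sum>b'\<in>{b'. (a, b', c) \<in> S}. J b' b * f (a, b', c)) +
     (- 1) ^ (dim1 a + dim1 b) * (\<Sum>c'\<in>{c'. (a, b, c') \<in> S}. J c' c * f (a, b, c'))"
proof -
  have line: "(\<Sum>\<sigma>\<in>S. if \<sigma> \<in> range g then F \<sigma> else 0) = (\<Sum>a'\<in>{a'. g a' \<in> S}. F (g a'))"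
    if "inj g" for g :: "cell1 \<Rightarrow> cell" and F :: "cell \<Rightarrow> real"
  proof -
    have "(\<Sum>\<sigma>\<in>S. if \<sigma> \<in> range g then F \<sigma> else 0) = (\<Sum>\<sigma>\<in>g ` {a'. g a' \<in> S}. F \<sigma>)"
      using assms by (intro sum.mono_neutral_cong_right) auto
    also have "\<dots> = (\<Sum>a'\<in>{a'. g a' \<in> S}. F (g a'))"
      using that by (subst sum.reindex) (auto intro: inj_on_subset)
    finally show ?thesis .
  qed
  let ?g1 = "\<lambda>a'. (a', b, c)" and ?g2 = "\<lambda>b'. (a, b', c)" and ?g3 = "\<lambda>c'. (a, b, c')"
  \<comment> \<open>The three summands of the incidence number are supported on the lines through the cell in the three directions.\<close>
  have split: "cell_incidence J \<sigma> (a, b, c) * f \<sigma> =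
    (if \<sigma> \<in> range ?g1 then J (fst \<sigma>) a * f \<sigma> else 0) +
    (- 1) ^ dim1 a * (if \<sigma> \<in> range ?g2 then J (fst (snd \<sigma>)) b * f \<sigma> else 0) +
    (- 1) ^ (dim1 a + dim1 b) * (if \<sigma> \<in> range ?g3 then J (snd (snd \<sigma>)) c * f \<sigma> else 0)" for \<sigma>
  proof -
    obtain a' b' c' where \<sigma>: "\<sigma> = (a', b', c')" by (cases \<sigma>)
    have "\<sigma> \<in> range ?g1 \<longleftrightarrow> b' = b \<and> c' = c" "\<sigma> \<in> range ?g2 \<longleftrightarrow> a' = a \<and> c' = c"
      "\<sigma> \<in> range ?g3 \<longleftrightarrow> a' = a \<and> b' = b"
      unfolding \<sigma> by blast+
    then show ?thesis
      by (simp only: \<sigma> cell_incidence.simps distrib_right fst_conv snd_conv if_distrib[of "\<lambda>z. z * _"]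
          if_distrib[of "\<lambda>z. _ * z"] mult_zero_left mult_zero_right mult.assoc)
  qed
  show ?thesis
    unfolding split sum.distrib
    unfolding sum_distrib_left[symmetric]
    by (subst (1 2 3) line) (simp_all add: inj_def)
qed

text \<open>The (co)boundary operator between functions on the cells in S and T, for the orientation \<open>\<omega>\<close>.\<close>
definition signed_cell_map ::
    "(cell1 \<Rightarrow> cell1 \<Rightarrow> real) \<Rightarrow> (cell \<Rightarrow> real) \<Rightarrow> cell set \<Rightarrow> cell set \<Rightarrow> (cell \<Rightarrow> real) \<Rightarrow> cell \<Rightarrow> real" where
  "signed_cell_map J \<omega> S T c =
     (\<lambda>\<tau>. if \<tau> \<in> T then \<Sum>\<sigma>\<in>S. \<omega> \<sigma> * \<omega> \<tau> * cell_incidence J \<sigma> \<tau> * c \<sigma> else 0)"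

section \<open>The complex spanned by product basis functions\<close>

text \<open>
  In each direction l, the basis functions of the larger space are labelled by the cells in \<open>F l\<close>,
  and those of the space of derivatives by the cells in \<open>G l\<close>. The sign e is \<open>(-1)\<^bsup>dim\<^esup>\<close> on F and also
  relates J to the derivative. All assumptions on functions concern the points outside K only.
\<close>
locale tensor_complex =
  fixes F G :: "3 \<Rightarrow> cell1 set" and \<beta> :: "3 \<Rightarrow> cell1 \<Rightarrow> real \<Rightarrow> real" and K :: "3 \<Rightarrow> real set"
    and J :: "cell1 \<Rightarrow> cell1 \<Rightarrow> real" and e :: real and \<omega> :: "cell \<Rightarrow> real"
  assumes finite_F: "finite (F l)" and finite_G: "finite (G l)"
    and sign_F: "a \<in> F l \<Longrightarrow> (- 1) ^ dim1 a = e" and sign_G: "b \<in> G l \<Longrightarrow> (- 1) ^ dim1 b = - e"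
    and e_square: "e * e = 1"
    and deriv_F: "\<lbrakk>a \<in> F l; t \<in> {0<..<1} - K l\<rbrakk> \<Longrightarrow>
      (\<beta> l a has_real_derivative e * (\<Sum>b\<in>G l. J a b * \<beta> l b t)) (at t)"
    and deriv_G: "\<lbrakk>b \<in> G l; t \<in> {0<..<1} - K l\<rbrakk> \<Longrightarrow> \<exists>D. (\<beta> l b has_real_derivative D) (at t)"
    and indep_F: "\<lbrakk>\<And>t. t \<in> {0<..<1} - K l \<Longrightarrow> (\<Sum>a\<in>F l. q a * \<beta> l a t) = 0; a \<in> F l\<rbrakk> \<Longrightarrow> q a = 0"
    and indep_G: "\<lbrakk>\<And>t. t \<in> {0<..<1} - K l \<Longrightarrow> (\<Sum>b\<in>G l. q b * \<beta> l b t) = 0; b \<in> G l\<rbrakk> \<Longrightarrow> q b = 0"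
    and orientation: "orientation \<omega>"
begin

text \<open>The points of the open unit cube none of whose coordinates is an exceptional one.\<close>
definition off_planes :: "(real^3) set" where
  "off_planes = {x \<in> unit_cube. \<forall>l. x $ l \<notin> K l}"

text \<open>In each direction one of the two families of univariate basis functions is selected.\<close>
definition admissible :: "(3 \<Rightarrow> cell1 set) \<Rightarrow> bool" where
  "admissible A \<longleftrightarrow> (\<forall>l. A l = F l \<or> A l = G l)"

lemma admissible_F [simp]: "admissible F" and admissible_G [simp]: "admissible G"
  and admissible_upd [simp]: "admissible A \<Longrightarrow> admissible (A(k := F k))" "admissible A \<Longrightarrow> admissible (A(k := G k))"
  by (auto simp: admissible_def)

lemma e_cases: "e = 1 \<or> e = - 1"
  using e_square by (simp add: square_eq_1_iff)

lemma disjoint_FG: "F l \<inter> G l = {}"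
proof -
  have "e \<noteq> - e" using e_cases by auto
  then show ?thesis using sign_F sign_G by fastforce
qed

lemma admissible_finite: "admissible A \<Longrightarrow> finite (A l)"
  unfolding admissible_def using finite_F finite_G by metis

lemma \<omega>_square [simp]: "\<omega> \<sigma> * \<omega> \<sigma> = 1" "\<omega> \<sigma> * (\<omega> \<sigma> * z) = z"
proof -
  have "\<omega> \<sigma> = 1 \<or> \<omega> \<sigma> = - 1" using orientation unfolding orientation_def by blast
  then show "\<omega> \<sigma> * \<omega> \<sigma> = 1" "\<omega> \<sigma> * (\<omega> \<sigma> * z) = z" by (elim disjE; simp)+
qed

lemma off_planes_cube: "x \<in> off_planes \<Longrightarrow> x \<in> unit_cube"
  by (simp add: off_planes_def)

lemma off_planes_coord: "x \<in> off_planes \<Longrightarrow> x $ l \<in> {0<..<1} - K l"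
  by (auto simp: off_planes_def unit_cube_def)

lemma indep_admissible:
  assumes "admissible A" "\<And>t. t \<in> {0<..<1} - K l \<Longrightarrow> (\<Sum>a\<in>A l. q a * \<beta> l a t) = 0" "a \<in> A l"
  shows "q a = 0"
  using assms indep_F[of l q a] indep_G[of l q a] unfolding admissible_def by metis

text \<open>Independence of the product functions follows by applying univariate independence in one direction after the other.\<close>
lemma tensor_sum_eq_0:
  assumes A: "admissible A" and zero: "\<And>x. x \<in> off_planes \<Longrightarrow> tensor_sum \<beta> A c x = 0"
    and \<sigma>: "\<sigma> \<in> cell_box A"
  shows "c \<sigma> = 0"
proof -
  obtain a1 a2 a3 where a: "\<sigma> = (a1, a2, a3)" "a1 \<in> A 1" "a2 \<in> A 2" "a3 \<in> A 3"
    using \<sigma> by (auto simp: cell_box_def)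
  have "(\<Sum>a1\<in>A 1. (\<Sum>a2\<in>A 2. (\<Sum>a3\<in>A 3. c (a1, a2, a3) * \<beta> 3 a3 t3) * \<beta> 2 a2 t2) * \<beta> 1 a1 t1) = 0"
    if "t1 \<in> {0<..<1} - K 1" "t2 \<in> {0<..<1} - K 2" "t3 \<in> {0<..<1} - K 3" for t1 t2 t3
  proof -
    define x :: "real^3" where "x = vector [t1, t2, t3]"
    have x: "x $ 1 = t1" "x $ 2 = t2" "x $ 3 = t3" by (simp_all add: x_def)
    then have "x \<in> off_planes" using that by (simp add: off_planes_def unit_cube_def forall_3)
    then have "0 = tensor_sum \<beta> A c x" using zero by simp
    also have "\<dots> = (\<Sum>a1\<in>A 1. \<Sum>a2\<in>A 2. \<Sum>a3\<in>A 3. c (a1, a2, a3) * (\<beta> 1 a1 t1 * \<beta> 2 a2 t2 * \<beta> 3 a3 t3))"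
      using \<open>x \<in> off_planes\<close> by (simp add: tensor_sum_nested off_planes_cube x)
    also have "\<dots> = (\<Sum>a1\<in>A 1. (\<Sum>a2\<in>A 2. (\<Sum>a3\<in>A 3. c (a1, a2, a3) * \<beta> 3 a3 t3) * \<beta> 2 a2 t2) * \<beta> 1 a1 t1)"
      unfolding sum_distrib_right by (intro sum.cong refl) (simp only: mult_ac)
    finally show ?thesis by simp
  qed
  then have "(\<Sum>a2\<in>A 2. (\<Sum>a3\<in>A 3. c (a1, a2, a3) * \<beta> 3 a3 t3) * \<beta> 2 a2 t2) = 0"
    if "t2 \<in> {0<..<1} - K 2" "t3 \<in> {0<..<1} - K 3" for t2 t3
    using that a(2)
    by (intro indep_admissible[OF A, where l = 1
        and q = "\<lambda>a1. \<Sum>a2\<in>A 2. (\<Sum>a3\<in>A 3. c (a1, a2, a3) * \<beta> 3 a3 t3) * \<beta> 2 a2 t2"])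
  then have "(\<Sum>a3\<in>A 3. c (a1, a2, a3) * \<beta> 3 a3 t3) = 0" if "t3 \<in> {0<..<1} - K 3" for t3
    using that a(3)
    by (intro indep_admissible[OF A, where l = 2 and q = "\<lambda>a2. \<Sum>a3\<in>A 3. c (a1, a2, a3) * \<beta> 3 a3 t3"])
  then show ?thesis
    unfolding a(1) using a(4) by (intro indep_admissible[OF A, where l = 3 and q = "\<lambda>a3. c (a1, a2, a3)"])
qed

lemma tensor_sum_inject:
  assumes A: "admissible A" and eq: "\<And>x. x \<in> off_planes \<Longrightarrow> tensor_sum \<beta> A c x = tensor_sum \<beta> A d x"
    and \<sigma>: "\<sigma> \<in> cell_box A"
  shows "c \<sigma> = d \<sigma>"
  using tensor_sum_eq_0[OF A _ \<sigma>, of "\<lambda>\<sigma>. 1 * c \<sigma> + (- 1) * d \<sigma>"] eq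
  by (simp only: tensor_sum_linear) simp

lemma tensor_sum_determined:
  assumes A: "admissible A" and "u \<in> range (tensor_sum \<beta> A)" "v \<in> range (tensor_sum \<beta> A)"
    and eq: "\<And>x. x \<in> off_planes \<Longrightarrow> u x = v x"
  shows "u = v"
proof -
  obtain c d where uv: "u = tensor_sum \<beta> A c" "v = tensor_sum \<beta> A d" using assms by auto
  show ?thesis
    unfolding uv by (rule tensor_sum_cong, rule tensor_sum_inject[OF A]) (use eq uv in auto)
qed

text \<open>The action of J on the k-th factor of the cells; it turns coefficients on F-cells into coefficients on G-cells.\<close>
definition difference :: "3 \<Rightarrow> (cell \<Rightarrow> real) \<Rightarrow> cell \<Rightarrow> real" where
  "difference k c = (\<lambda>(a1, a2, a3).
     if k = 1 then \<Sum>a\<in>F 1. J a a1 * c (a, a2, a3)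
     else if k = 2 then \<Sum>a\<in>F 2. J a a2 * c (a1, a, a3)
     else \<Sum>a\<in>F 3. J a a3 * c (a1, a2, a))"

text \<open>The k-th partial derivative, computed termwise.\<close>
definition partial :: "3 \<Rightarrow> (3 \<Rightarrow> cell1 set) \<Rightarrow> (cell \<Rightarrow> real) \<Rightarrow> real^3 \<Rightarrow> real" where
  "partial k A c = tensor_sum (\<beta>(k := \<lambda>a. deriv (\<beta> k a))) A c"

lemma tensor_sum_has_derivative:
  assumes A: "admissible A" and x: "x \<in> off_planes"
  shows "(tensor_sum \<beta> A c has_derivative (\<lambda>h. \<Sum>k\<in>UNIV. h $ k * partial k A c x)) (at x)"
proof -
  have d: "(\<beta> l a has_real_derivative deriv (\<beta> l a) (x $ l)) (at (x $ l))" if "a \<in> A l" for l a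
  proof -
    have "\<exists>D. (\<beta> l a has_real_derivative D) (at (x $ l))"
      using A that deriv_F[OF _ off_planes_coord[OF x], of a l] deriv_G[OF _ off_planes_coord[OF x], of a l]
      unfolding admissible_def by metis
    then show ?thesis using DERIV_imp_deriv by metis
  qed
  have "((\<lambda>y. \<Sum>\<sigma>\<in>cell_box A. c \<sigma> * tensor_fun \<beta> \<sigma> y) has_derivative
     (\<lambda>h. \<Sum>\<sigma>\<in>cell_box A. c \<sigma> * (\<Sum>k\<in>UNIV. h $ k * tensor_fun (\<beta>(k := \<lambda>a. deriv (\<beta> k a))) \<sigma> x))) (at x)"
  proof (intro has_derivative_sum has_derivative_mult_right)
    fix \<sigma> assume "\<sigma> \<in> cell_box A"
    then obtain a b c where "\<sigma> = (a, b, c)" "a \<in> A 1" "b \<in> A 2" "c \<in> A 3"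
      by (auto simp: cell_box_def)
    then show "(tensor_fun \<beta> \<sigma> has_derivative
        (\<lambda>h. \<Sum>k\<in>UNIV. h $ k * tensor_fun (\<beta>(k := \<lambda>a. deriv (\<beta> k a))) \<sigma> x)) (at x)"
      using tensor_fun_has_derivative d by blast
  qed
  then have "(tensor_sum \<beta> A c has_derivative
     (\<lambda>h. \<Sum>\<sigma>\<in>cell_box A. c \<sigma> * (\<Sum>k\<in>UNIV. h $ k * tensor_fun (\<beta>(k := \<lambda>a. deriv (\<beta> k a))) \<sigma> x))) (at x)"
    by (rule has_derivative_transform_within_open[OF _ open_unit_cube off_planes_cube[OF x]])
      (simp add: tensor_sum_def)
  moreover have "(\<Sum>\<sigma>\<in>cell_box A. c \<sigma> * (\<Sum>k\<in>UNIV. h $ k * tensor_fun (\<beta>(k := \<lambda>a. deriv (\<beta> k a))) \<sigma> x)) =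
      (\<Sum>k\<in>UNIV. h $ k * partial k A c x)" for h
  proof -
    have "(\<Sum>\<sigma>\<in>cell_box A. c \<sigma> * (\<Sum>k\<in>UNIV. h $ k * T k \<sigma>)) =
        (\<Sum>k\<in>UNIV. h $ k * (\<Sum>\<sigma>\<in>cell_box A. c \<sigma> * T k \<sigma>))" for T :: "3 \<Rightarrow> cell \<Rightarrow> real"
      unfolding sum_distrib_left by (subst sum.swap) (intro sum.cong refl, simp only: mult_ac)
    then show ?thesis using off_planes_cube[OF x] by (simp add: partial_def tensor_sum_def)
  qed
  ultimately show ?thesis by simp
qed

text \<open>In coordinates, partial differentiation is the difference operator.\<close>
lemma partial_eq_difference:
  assumes A: "admissible A" and k: "A k = F k" and x: "x \<in> off_planes"
  shows "partial k A c x = e * tensor_sum \<beta> (A(k := G k)) (difference k c) x"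
proof -
  have d: "deriv (\<beta> l a) (x $ l) = e * (\<Sum>b\<in>G l. J a b * \<beta> l b (x $ l))" if "a \<in> F l" for a l
    by (rule DERIV_imp_deriv[OF deriv_F[OF that off_planes_coord[OF x]]])
  have swap: "(\<Sum>a\<in>S. \<Sum>r\<in>R. c' a r * (e * (\<Sum>b\<in>T. J a b * f b) * g r)) =
      e * (\<Sum>b\<in>T. \<Sum>r\<in>R. (\<Sum>a\<in>S. J a b * c' a r) * (f b * g r))"
    for S T :: "cell1 set" and R :: "(cell1 \<times> cell1) set" and c' f g
  proof -
    have "(\<Sum>a\<in>S. \<Sum>r\<in>R. c' a r * (e * (\<Sum>b\<in>T. J a b * f b) * g r)) =
        (\<Sum>a\<in>S. \<Sum>r\<in>R. \<Sum>b\<in>T. e * (J a b * c' a r * (f b * g r)))"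
      unfolding sum_distrib_left sum_distrib_right by (intro sum.cong refl) (simp only: mult_ac)
    also have "\<dots> = (\<Sum>r\<in>R. \<Sum>a\<in>S. \<Sum>b\<in>T. e * (J a b * c' a r * (f b * g r)))"
      by (rule sum.swap)
    also have "\<dots> = (\<Sum>r\<in>R. \<Sum>b\<in>T. \<Sum>a\<in>S. e * (J a b * c' a r * (f b * g r)))"
      by (intro sum.cong refl sum.swap)
    also have "\<dots> = (\<Sum>b\<in>T. \<Sum>r\<in>R. \<Sum>a\<in>S. e * (J a b * c' a r * (f b * g r)))"
      by (rule sum.swap)
    finally show ?thesis by (simp only: sum_distrib_left sum_distrib_right)
  qed
  have regroup: "(\<Sum>a1\<in>S1. \<Sum>a2\<in>S2. \<Sum>a3\<in>S3. f a1 a2 a3) = (\<Sum>a1\<in>S1. \<Sum>(a2, a3)\<in>S2 \<times> S3. f a1 a2 a3)"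
    "(\<Sum>a1\<in>S1. \<Sum>a2\<in>S2. \<Sum>a3\<in>S3. f a1 a2 a3) = (\<Sum>a2\<in>S2. \<Sum>(a1, a3)\<in>S1 \<times> S3. f a1 a2 a3)"
    "(\<Sum>a1\<in>S1. \<Sum>a2\<in>S2. \<Sum>a3\<in>S3. f a1 a2 a3) = (\<Sum>a3\<in>S3. \<Sum>(a1, a2)\<in>S1 \<times> S2. f a1 a2 a3)"
    for S1 S2 S3 :: "cell1 set" and f :: "cell1 \<Rightarrow> cell1 \<Rightarrow> cell1 \<Rightarrow> real"
  proof -
    show "(\<Sum>a1\<in>S1. \<Sum>a2\<in>S2. \<Sum>a3\<in>S3. f a1 a2 a3) = (\<Sum>a1\<in>S1. \<Sum>(a2, a3)\<in>S2 \<times> S3. f a1 a2 a3)"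
      by (simp add: sum.cartesian_product)
    show "(\<Sum>a1\<in>S1. \<Sum>a2\<in>S2. \<Sum>a3\<in>S3. f a1 a2 a3) = (\<Sum>a2\<in>S2. \<Sum>(a1, a3)\<in>S1 \<times> S3. f a1 a2 a3)"
      by (rule trans[OF sum.swap]) (simp add: sum.cartesian_product)
    show "(\<Sum>a1\<in>S1. \<Sum>a2\<in>S2. \<Sum>a3\<in>S3. f a1 a2 a3) = (\<Sum>a3\<in>S3. \<Sum>(a1, a2)\<in>S1 \<times> S2. f a1 a2 a3)"
    proof -
      have "(\<Sum>a1\<in>S1. \<Sum>a2\<in>S2. \<Sum>a3\<in>S3. f a1 a2 a3) = (\<Sum>a1\<in>S1. \<Sum>a3\<in>S3. \<Sum>a2\<in>S2. f a1 a2 a3)"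
        by (intro sum.cong refl sum.swap)
      also have "\<dots> = (\<Sum>a3\<in>S3. \<Sum>a1\<in>S1. \<Sum>a2\<in>S2. f a1 a2 a3)"
        by (rule sum.swap)
      finally show ?thesis by (simp add: sum.cartesian_product)
    qed
  qed
  note nested = tensor_sum_nested[OF off_planes_cube[OF x]]
  consider "k = 1" | "k = 2" | "k = 3" using exhaust_3 by blast
  then show ?thesis
  proof cases
    case 1
    have "partial k A c x = (\<Sum>a\<in>F 1. \<Sum>r\<in>A 2 \<times> A 3. c (a, fst r, snd r) *
        (e * (\<Sum>b\<in>G 1. J a b * \<beta> 1 b (x $ 1)) * (\<beta> 2 (fst r) (x $ 2) * \<beta> 3 (snd r) (x $ 3))))"
      using 1 k unfolding partial_def nested regroup(1) by (auto simp: d mult.assoc intro!: sum.cong)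
    also note swap
    also have "(\<Sum>b\<in>G 1. \<Sum>r\<in>A 2 \<times> A 3. (\<Sum>a\<in>F 1. J a b * c (a, fst r, snd r)) *
        (\<beta> 1 b (x $ 1) * (\<beta> 2 (fst r) (x $ 2) * \<beta> 3 (snd r) (x $ 3)))) =
        tensor_sum \<beta> (A(k := G k)) (difference k c) x"
      using 1 unfolding nested regroup(1) by (auto simp: difference_def mult.assoc intro!: sum.cong)
    finally show ?thesis .
  next
    case 2
    have "partial k A c x = (\<Sum>a\<in>F 2. \<Sum>r\<in>A 1 \<times> A 3. c (fst r, a, snd r) *
        (e * (\<Sum>b\<in>G 2. J a b * \<beta> 2 b (x $ 2)) * (\<beta> 1 (fst r) (x $ 1) * \<beta> 3 (snd r) (x $ 3))))"
      using 2 k unfolding partial_def nested regroup(2) by (auto simp: d mult_ac intro!: sum.cong)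
    also note swap
    also have "(\<Sum>b\<in>G 2. \<Sum>r\<in>A 1 \<times> A 3. (\<Sum>a\<in>F 2. J a b * c (fst r, a, snd r)) *
        (\<beta> 2 b (x $ 2) * (\<beta> 1 (fst r) (x $ 1) * \<beta> 3 (snd r) (x $ 3)))) =
        tensor_sum \<beta> (A(k := G k)) (difference k c) x"
      using 2 unfolding nested regroup(2) by (auto simp: difference_def mult_ac intro!: sum.cong)
    finally show ?thesis .
  next
    case 3
    have "partial k A c x = (\<Sum>a\<in>F 3. \<Sum>r\<in>A 1 \<times> A 2. c (fst r, snd r, a) *
        (e * (\<Sum>b\<in>G 3. J a b * \<beta> 3 b (x $ 3)) * (\<beta> 1 (fst r) (x $ 1) * \<beta> 2 (snd r) (x $ 2))))"
      using 3 k unfolding partial_def nested regroup(3) by (auto simp: d mult_ac intro!: sum.cong)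
    also note swap
    also have "(\<Sum>b\<in>G 3. \<Sum>r\<in>A 1 \<times> A 2. (\<Sum>a\<in>F 3. J a b * c (fst r, snd r, a)) *
        (\<beta> 3 b (x $ 3) * (\<beta> 1 (fst r) (x $ 1) * \<beta> 2 (snd r) (x $ 2)))) =
        tensor_sum \<beta> (A(k := G k)) (difference k c) x"
      using 3 unfolding nested regroup(3) by (auto simp: difference_def mult_ac intro!: sum.cong)
    finally show ?thesis .
  qed
qed

text \<open>The cells with one, respectively two factors in G. They label the components of vector fields in \<open>X\<^sup>1\<close> and \<open>X\<^sup>2\<close>.\<close>
definition C1 :: "cell set" where "C1 = (\<Union>k. cell_box (F(k := G k)))"
definition C2 :: "cell set" where "C2 = (\<Union>k. cell_box (G(k := F k)))"

lemma mem_F: "(a, b, c) \<in> cell_box F \<longleftrightarrow> a \<in> F 1 \<and> b \<in> F 2 \<and> c \<in> F 3"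
  and mem_C1: "(a, b, c) \<in> C1 \<longleftrightarrow> a \<in> G 1 \<and> b \<in> F 2 \<and> c \<in> F 3 \<or>
    a \<in> F 1 \<and> b \<in> G 2 \<and> c \<in> F 3 \<or> a \<in> F 1 \<and> b \<in> F 2 \<and> c \<in> G 3"
  and mem_C2: "(a, b, c) \<in> C2 \<longleftrightarrow> a \<in> F 1 \<and> b \<in> G 2 \<and> c \<in> G 3 \<or>
    a \<in> G 1 \<and> b \<in> F 2 \<and> c \<in> G 3 \<or> a \<in> G 1 \<and> b \<in> G 2 \<and> c \<in> F 3"
  by (auto simp: cell_box_def C1_def C2_def ex_3)

lemma finite_cells: "finite (cell_box F)" "finite C1" "finite C2" "finite (cell_box G)"
proof -
  have "finite (cell_box A)" if "admissible A" for A
    by (rule finite_cell_box, rule admissible_finite[OF that])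
  then show "finite (cell_box F)" "finite C1" "finite C2" "finite (cell_box G)"
    by (simp_all add: C1_def C2_def)
qed

lemma disjoint_boxes:
  assumes "j \<noteq> k"
  shows "cell_box (F(j := G j)) \<inter> cell_box (F(k := G k)) = {}"
    "cell_box (G(j := F j)) \<inter> cell_box (G(k := F k)) = {}"
  using assms exhaust_3[of j] exhaust_3[of k] disjoint_FG[of 1] disjoint_FG[of 2] disjoint_FG[of 3]
  by (auto simp: cell_box_def)

text \<open>The change of signs from the orientation \<open>\<omega>\<close> to the product orientation.\<close>
definition twist :: "(cell \<Rightarrow> real) \<Rightarrow> cell \<Rightarrow> real" where
  "twist c = (\<lambda>\<sigma>. \<omega> \<sigma> * c \<sigma>)"

text \<open>The isomorphisms from functions on cells to scalar fields and vector fields, with signs s for the components.\<close>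
definition scalar_field :: "(3 \<Rightarrow> cell1 set) \<Rightarrow> (cell \<Rightarrow> real) \<Rightarrow> real^3 \<Rightarrow> real" where
  "scalar_field A c = tensor_sum \<beta> A (twist c)"

definition vector_field ::
    "(3 \<Rightarrow> 3 \<Rightarrow> cell1 set) \<Rightarrow> (3 \<Rightarrow> real) \<Rightarrow> (cell \<Rightarrow> real) \<Rightarrow> real^3 \<Rightarrow> real^3" where
  "vector_field B s c = (\<lambda>x. \<chi> k. s k * tensor_sum \<beta> (B k) (twist c) x)"

text \<open>Vector fields whose k-th component is spanned by the product functions in \<open>B k\<close>.\<close>
definition vector_fields :: "(3 \<Rightarrow> 3 \<Rightarrow> cell1 set) \<Rightarrow> (real^3 \<Rightarrow> real^3) set" where
  "vector_fields B = {v. \<forall>k. (\<lambda>x. v x $ k) \<in> range (tensor_sum \<beta> (B k))}"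

lemma twist_linear: "twist (\<lambda>\<sigma>. r * c \<sigma> + q * d \<sigma>) = (\<lambda>\<sigma>. r * twist c \<sigma> + q * twist d \<sigma>)"
  by (rule ext) (simp add: twist_def algebra_simps)

lemma vector_field_linear:
  "vector_field B s (\<lambda>\<sigma>. r * c \<sigma> + q * d \<sigma>) = (\<lambda>x. r *\<^sub>R vector_field B s c x + q *\<^sub>R vector_field B s d x)"
  unfolding vector_field_def twist_linear tensor_sum_linear
  by (simp add: fun_eq_iff vec_eq_iff algebra_simps)

lemma scalar_field_linear:
  "scalar_field A (\<lambda>\<sigma>. r * c \<sigma> + q * d \<sigma>) = (\<lambda>x. r *\<^sub>R scalar_field A c x + q *\<^sub>R scalar_field A d x)"
  unfolding scalar_field_def twist_linear tensor_sum_linear by (simp add: fun_eq_iff)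

lemma twist_inject: "twist c \<sigma> = twist d \<sigma> \<longleftrightarrow> c \<sigma> = d \<sigma>"
  by (metis \<omega>_square(2) twist_def)

lemma bij_scalar_field:
  assumes A: "admissible A"
  shows "bij_betw (scalar_field A) (functions_on_cells (cell_box A)) (range (tensor_sum \<beta> A))"
  unfolding bij_betw_def
proof (intro conjI inj_onI equalityI subsetI)
  fix c d assume "c \<in> functions_on_cells (cell_box A)" "d \<in> functions_on_cells (cell_box A)"
    and eq: "scalar_field A c = scalar_field A d"
  moreover have "c \<sigma> = d \<sigma>" if "\<sigma> \<in> cell_box A" for \<sigma>
    using tensor_sum_inject[OF A _ that, of "twist c" "twist d"] eq
    by (simp add: scalar_field_def twist_inject)
  ultimately show "c = d" by (blast intro: functions_on_cells_eqI)
next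
  fix u assume "u \<in> range (tensor_sum \<beta> A)"
  then obtain c where u: "u = tensor_sum \<beta> A c" by auto
  let ?d = "\<lambda>\<sigma>. if \<sigma> \<in> cell_box A then twist c \<sigma> else 0"
  have "scalar_field A ?d = u"
    unfolding scalar_field_def u by (rule tensor_sum_cong) (simp add: twist_def)
  moreover have "?d \<in> functions_on_cells (cell_box A)" by (simp add: functions_on_cells_def)
  ultimately show "u \<in> scalar_field A ` functions_on_cells (cell_box A)" by blast
qed (auto simp: scalar_field_def)

lemma bij_vector_field:
  assumes A: "\<And>k. admissible (B k)" and disj: "\<And>j k. j \<noteq> k \<Longrightarrow> cell_box (B j) \<inter> cell_box (B k) = {}"
    and s: "\<And>k. s k * s k = 1"
  shows "bij_betw (vector_field B s) (functions_on_cells (\<Union>k. cell_box (B k))) (vector_fields B)"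
  unfolding bij_betw_def
proof (intro conjI inj_onI equalityI subsetI)
  fix c d assume "c \<in> functions_on_cells (\<Union>k. cell_box (B k))" "d \<in> functions_on_cells (\<Union>k. cell_box (B k))"
    and eq: "vector_field B s c = vector_field B s d"
  moreover have "c \<sigma> = d \<sigma>" if "\<sigma> \<in> cell_box (B k)" for \<sigma> k
  proof -
    have "tensor_sum \<beta> (B k) (twist c) x = tensor_sum \<beta> (B k) (twist d) x" for x
    proof -
      have "s k \<noteq> 0" using s[of k] by auto
      moreover have "vector_field B s c x $ k = vector_field B s d x $ k" using eq by simp
      ultimately show ?thesis by (simp add: vector_field_def)
    qed
    then show ?thesis
      using tensor_sum_inject[OF A[of k] _ that, of "twist c" "twist d"] by (simp add: twist_inject)
  qed
  ultimately show "c = d" by (blast intro: functions_on_cells_eqI)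
next
  fix v assume "v \<in> vector_field B s ` functions_on_cells (\<Union>k. cell_box (B k))"
  then obtain c where v: "v = vector_field B s c" by auto
  have "(\<lambda>x. v x $ k) = tensor_sum \<beta> (B k) (\<lambda>\<sigma>. s k * twist c \<sigma>)" for k
    by (simp add: v vector_field_def fun_eq_iff tensor_sum_scale)
  then show "v \<in> vector_fields B" by (auto simp: vector_fields_def)
next
  fix v assume "v \<in> vector_fields B"
  then have "\<forall>k. \<exists>c. (\<lambda>x. v x $ k) = tensor_sum \<beta> (B k) c" by (auto simp: vector_fields_def)
  then obtain c where c: "\<And>k. (\<lambda>x. v x $ k) = tensor_sum \<beta> (B k) (c k)" by metis
  define d where "d \<sigma> = (\<Sum>k\<in>UNIV. if \<sigma> \<in> cell_box (B k) then s k * twist (c k) \<sigma> else 0)" for \<sigma>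
  have d: "d \<sigma> = s k * twist (c k) \<sigma>" if "\<sigma> \<in> cell_box (B k)" for \<sigma> k
  proof -
    have "d \<sigma> = (\<Sum>j\<in>UNIV. if j = k then s k * twist (c k) \<sigma> else 0)"
      unfolding d_def using that disj by (intro sum.cong) auto
    then show ?thesis by simp
  qed
  have "v x $ k = vector_field B s d x $ k" for x k
  proof -
    have "tensor_sum \<beta> (B k) (twist d) = tensor_sum \<beta> (B k) (\<lambda>\<sigma>. s k * c k \<sigma>)"
      by (rule tensor_sum_cong) (simp add: d twist_def mult.left_commute)
    then have "vector_field B s d x $ k = s k * s k * tensor_sum \<beta> (B k) (c k) x"
      by (simp add: vector_field_def tensor_sum_scale)
    then show ?thesis using fun_cong[OF c, of x] by (simp add: s)
  qed
  then have "v = vector_field B s d" by (simp add: fun_eq_iff vec_eq_iff)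
  moreover have "d \<in> functions_on_cells (\<Union>k. cell_box (B k))"
    by (auto simp: functions_on_cells_def d_def)
  ultimately show "v \<in> vector_field B s ` functions_on_cells (\<Union>k. cell_box (B k))" by blast
qed

text \<open>With \<open>tensor_sum_determined\<close> this makes gradient, curl and divergence single-valued, although
  they are prescribed off the knot planes only.\<close>
lemma vector_fields_determined:
  assumes "\<And>k. admissible (B k)" "v \<in> vector_fields B" "w \<in> vector_fields B"
    and "\<And>x. x \<in> off_planes \<Longrightarrow> v x = w x"
  shows "v = w"
proof -
  have "(\<lambda>x. v x $ k) = (\<lambda>x. w x $ k)" for k
    by (rule tensor_sum_determined[OF assms(1)[of k]]) (use assms(2-4) in \<open>auto simp: vector_fields_def\<close>)
  then show ?thesis by (simp add: fun_eq_iff vec_eq_iff)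
qed

abbreviation "cell_map \<equiv> signed_cell_map J \<omega>"

lemma cell_map_in: "cell_map S T c \<in> functions_on_cells T"
  by (simp add: signed_cell_map_def functions_on_cells_def)

lemma twist_cell_map:
  assumes "finite S" "(a, b, d) \<in> T"
  shows "twist (cell_map S T c) (a, b, d) =
     (\<Sum>a'\<in>{a'. (a', b, d) \<in> S}. J a' a * twist c (a', b, d)) +
     (- 1) ^ dim1 a * (\<Sum>b'\<in>{b'. (a, b', d) \<in> S}. J b' b * twist c (a, b', d)) +
     (- 1) ^ dim1 a * (- 1) ^ dim1 b * (\<Sum>d'\<in>{d'. (a, b, d') \<in> S}. J d' d * twist c (a, b, d'))"
proof -
  have "twist (cell_map S T c) (a, b, d) = (\<Sum>\<sigma>\<in>S. cell_incidence J \<sigma> (a, b, d) * twist c \<sigma>)"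
  proof -
    have "\<omega> \<tau> * (\<omega> \<sigma> * \<omega> \<tau> * z * c \<sigma>) = z * (\<omega> \<sigma> * c \<sigma>)" for \<sigma> \<tau> z
    proof -
      have "\<omega> \<tau> * (\<omega> \<sigma> * \<omega> \<tau> * z * c \<sigma>) = (\<omega> \<tau> * \<omega> \<tau>) * (z * (\<omega> \<sigma> * c \<sigma>))" by (simp only: mult_ac)
      then show ?thesis by simp
    qed
    then show ?thesis
      unfolding twist_def signed_cell_map_def by (simp only: assms(2) if_True sum_distrib_left)
  qed
  then show ?thesis
    by (simp only: sum_cell_incidence[OF assms(1)] power_add)
qed

text \<open>
  The next three lemmas express the (co)boundary operator by difference operators. All signs
  arise from \<open>(-1)\<^bsup>dim\<^esup> = e\<close> for factors in F and \<open>- e\<close> for factors in G.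
\<close>
lemma twist_gradient:
  assumes "\<tau> \<in> cell_box (F(k := G k))"
  shows "twist (cell_map (cell_box F) C1 c) \<tau> = (if k = 2 then e else 1) * difference k (twist c) \<tau>"
proof -
  obtain a b d where \<tau>: "\<tau> = (a, b, d)" by (cases \<tau>)
  have C1: "(a, b, d) \<in> C1" using assms by (auto simp: C1_def \<tau>)
  note D = disjoint_FG[of 1] disjoint_FG[of 2] disjoint_FG[of 3]
  consider "k = 1" "a \<in> G 1" "b \<in> F 2" "d \<in> F 3" | "k = 2" "a \<in> F 1" "b \<in> G 2" "d \<in> F 3"
    | "k = 3" "a \<in> F 1" "b \<in> F 2" "d \<in> G 3"
    using exhaust_3[of k] assms by (auto simp: \<tau> cell_box_def)
  then show ?thesis
  proof cases
    case 1
    then have "{a'. (a', b, d) \<in> cell_box F} = F 1" "{b'. (a, b', d) \<in> cell_box F} = {}"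
      "{d'. (a, b, d') \<in> cell_box F} = {}"
      using D by (auto simp: mem_F)
    then show ?thesis
      unfolding \<tau> twist_cell_map[OF finite_cells(1) C1] using 1 by (simp add: difference_def)
  next
    case 2
    then have "{a'. (a', b, d) \<in> cell_box F} = {}" "{b'. (a, b', d) \<in> cell_box F} = F 2"
      "{d'. (a, b, d') \<in> cell_box F} = {}"
      using D by (auto simp: mem_F)
    then show ?thesis
      unfolding \<tau> twist_cell_map[OF finite_cells(1) C1] using 2 by (simp add: difference_def sign_F)
  next
    case 3
    then have "{a'. (a', b, d) \<in> cell_box F} = {}" "{b'. (a, b', d) \<in> cell_box F} = {}"
      "{d'. (a, b, d') \<in> cell_box F} = F 3"
      using D by (auto simp: mem_F)
    then show ?thesis
      unfolding \<tau> twist_cell_map[OF finite_cells(1) C1] using 3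
      by (simp add: difference_def sign_F e_square)
  qed
qed

lemma twist_curl:
  assumes "\<tau> \<in> cell_box (G(k := F k))"
  shows "twist (cell_map C1 C2 c) \<tau> =
    (if k = 1 then e * difference 2 (twist c) \<tau> + (- 1) * difference 3 (twist c) \<tau>
     else if k = 2 then 1 * difference 1 (twist c) \<tau> + (- 1) * difference 3 (twist c) \<tau>
     else 1 * difference 1 (twist c) \<tau> + (- e) * difference 2 (twist c) \<tau>)"
proof -
  obtain a b d where \<tau>: "\<tau> = (a, b, d)" by (cases \<tau>)
  have C2: "(a, b, d) \<in> C2" using assms by (auto simp: C2_def \<tau>)
  note D = disjoint_FG[of 1] disjoint_FG[of 2] disjoint_FG[of 3]
  consider "k = 1" "a \<in> F 1" "b \<in> G 2" "d \<in> G 3" | "k = 2" "a \<in> G 1" "b \<in> F 2" "d \<in> G 3"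
    | "k = 3" "a \<in> G 1" "b \<in> G 2" "d \<in> F 3"
    using exhaust_3[of k] assms by (auto simp: \<tau> cell_box_def)
  then show ?thesis
  proof cases
    case 1
    then have "{a'. (a', b, d) \<in> C1} = {}" "{b'. (a, b', d) \<in> C1} = F 2" "{d'. (a, b, d') \<in> C1} = F 3"
      using D by (auto simp: mem_C1)
    then show ?thesis
      unfolding \<tau> twist_cell_map[OF finite_cells(2) C2] using 1
      by (simp add: difference_def sign_F sign_G e_square)
  next
    case 2
    then have "{a'. (a', b, d) \<in> C1} = F 1" "{b'. (a, b', d) \<in> C1} = {}" "{d'. (a, b, d') \<in> C1} = F 3"
      using D by (auto simp: mem_C1)
    then show ?thesis
      unfolding \<tau> twist_cell_map[OF finite_cells(2) C2] using 2
      by (simp add: difference_def sign_F sign_G e_square)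
  next
    case 3
    then have "{a'. (a', b, d) \<in> C1} = F 1" "{b'. (a, b', d) \<in> C1} = F 2" "{d'. (a, b, d') \<in> C1} = {}"
      using D by (auto simp: mem_C1)
    then show ?thesis
      unfolding \<tau> twist_cell_map[OF finite_cells(2) C2] using 3
      by (simp add: difference_def sign_F sign_G e_square)
  qed
qed

lemma twist_divergence:
  assumes "\<tau> \<in> cell_box G"
  shows "twist (cell_map C2 (cell_box G) c) \<tau> =
    1 * (1 * difference 1 (twist c) \<tau> + (- e) * difference 2 (twist c) \<tau>) + 1 * difference 3 (twist c) \<tau>"
proof -
  obtain a b d where \<tau>: "\<tau> = (a, b, d)" by (cases \<tau>)
  have abd: "a \<in> G 1" "b \<in> G 2" "d \<in> G 3" using assms by (auto simp: \<tau> cell_box_def)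
  then have "{a'. (a', b, d) \<in> C2} = F 1" "{b'. (a, b', d) \<in> C2} = F 2" "{d'. (a, b, d') \<in> C2} = F 3"
    using disjoint_FG[of 1] disjoint_FG[of 2] disjoint_FG[of 3] by (auto simp: mem_C2)
  then show ?thesis
    unfolding \<tau> twist_cell_map[OF finite_cells(3) assms[unfolded \<tau>]] using abd
    by (simp add: difference_def sign_G e_square)
qed

text \<open>The index sets of the components of \<open>X\<^sup>1\<close> and \<open>X\<^sup>2\<close>: exactly one factor lies in G, respectively F.\<close>
abbreviation "one_G \<equiv> \<lambda>k. F(k := G k)"
abbreviation "one_F \<equiv> \<lambda>k. G(k := F k)"
text \<open>
  The signs of the components for which the (co)boundary operator becomes gradient, curl and
  divergence. They are read off from the coefficients in the three lemmas above.
\<close>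
definition sign1 :: "3 \<Rightarrow> real" where "sign1 k = (if k = 2 then 1 else e)"
definition sign2 :: "3 \<Rightarrow> real" where "sign2 k = (if k = 2 then - 1 else e)"

lemma grad_scalar_field:
  "grad_on off_planes (scalar_field F c) (vector_field one_G sign1 (cell_map (cell_box F) C1 c))"
  unfolding grad_on_def
proof
  fix x assume x: "x \<in> off_planes"
  let ?v = "vector_field one_G sign1 (cell_map (cell_box F) C1 c) x"
  have "partial k F (twist c) x = ?v $ k" for k
  proof -
    have "tensor_sum \<beta> (one_G k) (twist (cell_map (cell_box F) C1 c)) =
        tensor_sum \<beta> (one_G k) (\<lambda>\<tau>. (if k = 2 then e else 1) * difference k (twist c) \<tau>)"
      by (rule tensor_sum_cong) (rule twist_gradient)
    then show ?thesis
      by (simp add: partial_eq_difference[OF _ _ x] vector_field_def sign1_def tensor_sum_scale)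
  qed
  then show "GDERIV (scalar_field F c) x :> ?v"
    using tensor_sum_has_derivative[OF admissible_F x, of "twist c"]
    by (simp add: gderiv_def scalar_field_def inner_vec_def)
qed

lemma vector_field_jacobian:
  assumes "\<And>k. admissible (B k)" "x \<in> off_planes"
  shows "vector_field B s c differentiable (at x)"
    "jacobian (vector_field B s c) (at x) $ k $ j = s k * partial j (B k) (twist c) x"
proof -
  have "((\<lambda>x. vector_field B s c x $ k) has_derivative
      (\<lambda>h. \<Sum>j\<in>UNIV. h $ j * (s k * partial j (B k) (twist c) x))) (at x)" for k
    using has_derivative_mult_right[OF tensor_sum_has_derivative[OF assms(1)[of k] assms(2), of "twist c"], of "s k"]
    by (simp add: vector_field_def sum_distrib_left mult_ac)
  from jacobian_eqI[OF this] show "vector_field B s c differentiable (at x)"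
    "jacobian (vector_field B s c) (at x) $ k $ j = s k * partial j (B k) (twist c) x" .
qed

lemma one_G_upd:
  "(one_G 1)(2 := G 2) = one_F 3" "(one_G 1)(3 := G 3) = one_F 2" "(one_G 2)(1 := G 1) = one_F 3"
  "(one_G 2)(3 := G 3) = one_F 1" "(one_G 3)(1 := G 1) = one_F 2" "(one_G 3)(2 := G 2) = one_F 1"
  "(one_F k)(k := G k) = G"
  by (auto simp: fun_eq_iff forall_3)

lemma curl_vector_field:
  "curl_on off_planes (vector_field one_G sign1 c) (vector_field one_F sign2 (cell_map C1 C2 c))"
  unfolding curl_on_def Let_def
proof (intro ballI conjI)
  fix x assume x: "x \<in> off_planes"
  let ?u = "vector_field one_G sign1 c" and ?v = "vector_field one_F sign2 (cell_map C1 C2 c) x"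
  have J: "jacobian ?u (at x) $ k $ j = sign1 k * partial j (one_G k) (twist c) x" for k j
    by (rule vector_field_jacobian[OF _ x]) simp
  show "?u differentiable (at x)" by (rule vector_field_jacobian[OF _ x]) simp
  have P: "partial j (one_G k) (twist c) x = e * tensor_sum \<beta> ((one_G k)(j := G j)) (difference j (twist c)) x"
    if "j \<noteq> k" for j k
    using that by (intro partial_eq_difference x) auto
  have v: "?v $ k = sign2 k * (r * tensor_sum \<beta> (one_F k) (difference i (twist c)) x +
      q * tensor_sum \<beta> (one_F k) (difference j (twist c)) x)"
    if "\<And>\<tau>. \<tau> \<in> cell_box (one_F k) \<Longrightarrow> twist (cell_map C1 C2 c) \<tau> =
        r * difference i (twist c) \<tau> + q * difference j (twist c) \<tau>" for k i j r q
  proof -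
    have "?v $ k = sign2 k * tensor_sum \<beta> (one_F k) (twist (cell_map C1 C2 c)) x"
      by (simp add: vector_field_def)
    also have "tensor_sum \<beta> (one_F k) (twist (cell_map C1 C2 c)) =
        tensor_sum \<beta> (one_F k) (\<lambda>\<tau>. r * difference i (twist c) \<tau> + q * difference j (twist c) \<tau>)"
      by (rule tensor_sum_cong) (rule that)
    finally show ?thesis by (simp only: tensor_sum_linear)
  qed
  have v1: "?v $ 1 = sign2 1 * (e * tensor_sum \<beta> (one_F 1) (difference 2 (twist c)) x +
      (- 1) * tensor_sum \<beta> (one_F 1) (difference 3 (twist c)) x)"
    by (rule v, rule trans[OF twist_curl[of _ 1]]) simp_all
  have v2: "?v $ 2 = sign2 2 * (1 * tensor_sum \<beta> (one_F 2) (difference 1 (twist c)) x +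
      (- 1) * tensor_sum \<beta> (one_F 2) (difference 3 (twist c)) x)"
    by (rule v, rule trans[OF twist_curl[of _ 2]]) simp_all
  have v3: "?v $ 3 = sign2 3 * (1 * tensor_sum \<beta> (one_F 3) (difference 1 (twist c)) x +
      (- e) * tensor_sum \<beta> (one_F 3) (difference 2 (twist c)) x)"
    by (rule v, rule trans[OF twist_curl[of _ 3]]) simp_all
  show "?v = vector [jacobian ?u (at x) $ 3 $ 2 - jacobian ?u (at x) $ 2 $ 3,
      jacobian ?u (at x) $ 1 $ 3 - jacobian ?u (at x) $ 3 $ 1,
      jacobian ?u (at x) $ 2 $ 1 - jacobian ?u (at x) $ 1 $ 2]"
    unfolding vec_eq_iff forall_3 vector_3 v1 v2 v3
    using e_cases by (auto simp: J P one_G_upd sign1_def sign2_def)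
qed

lemma div_vector_field:
  "div_on off_planes (vector_field one_F sign2 c) (scalar_field G (cell_map C2 (cell_box G) c))"
  unfolding div_on_def
proof (intro ballI conjI)
  fix x assume x: "x \<in> off_planes"
  let ?u = "vector_field one_F sign2 c"
  have J: "jacobian ?u (at x) $ k $ k = sign2 k * (e * tensor_sum \<beta> G (difference k (twist c)) x)" for k
    by (subst vector_field_jacobian[OF _ x]) (simp_all add: partial_eq_difference[OF _ _ x] one_G_upd)
  show "?u differentiable (at x)" by (rule vector_field_jacobian[OF _ x]) simp
  have "scalar_field G (cell_map C2 (cell_box G) c) x = tensor_sum \<beta> G (\<lambda>\<tau>.
      1 * (1 * difference 1 (twist c) \<tau> + (- e) * difference 2 (twist c) \<tau>) + 1 * difference 3 (twist c) \<tau>) x"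
    unfolding scalar_field_def by (rule fun_cong[OF tensor_sum_cong[OF twist_divergence]])
  then show "scalar_field G (cell_map C2 (cell_box G) c) x = trace (jacobian ?u (at x))"
    using e_cases unfolding tensor_sum_linear by (auto simp: trace_def sum_3 J sign2_def)
qed

theorem complex_isomorphism:
  "\<exists>\<phi>0 \<phi>1 \<phi>2 \<phi>3.
     linear_iso (range (tensor_sum \<beta> F)) (functions_on_cells (cell_box F)) \<phi>0 \<and>
     linear_iso (vector_fields one_G) (functions_on_cells C1) \<phi>1 \<and>
     linear_iso (vector_fields one_F) (functions_on_cells C2) \<phi>2 \<and>
     linear_iso (range (tensor_sum \<beta> G)) (functions_on_cells (cell_box G)) \<phi>3 \<and>
     intertwines (range (tensor_sum \<beta> F)) (grad_on off_planes) (vector_fields one_G) \<phi>0 (cell_map (cell_box F) C1) \<phi>1 \<and>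
     intertwines (vector_fields one_G) (curl_on off_planes) (vector_fields one_F) \<phi>1 (cell_map C1 C2) \<phi>2 \<and>
     intertwines (vector_fields one_F) (div_on off_planes) (range (tensor_sum \<beta> G)) \<phi>2 (cell_map C2 (cell_box G)) \<phi>3"
proof -
  note b0 = bij_scalar_field[OF admissible_F] and b3 = bij_scalar_field[OF admissible_G]
  have b1: "bij_betw (vector_field one_G sign1) (functions_on_cells C1) (vector_fields one_G)"
    unfolding C1_def by (rule bij_vector_field) (auto simp: disjoint_boxes sign1_def e_square)
  have b2: "bij_betw (vector_field one_F sign2) (functions_on_cells C2) (vector_fields one_F)"
    unfolding C2_def by (rule bij_vector_field) (auto simp: disjoint_boxes sign2_def e_square)
  have u1: "v = w" if "v \<in> vector_fields one_G" "w \<in> vector_fields one_G" "grad_on off_planes u v" "grad_on off_planes u w" for u v w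
  proof (rule vector_fields_determined[OF _ that(1,2)])
    fix x assume "x \<in> off_planes"
    then have "(u has_derivative (\<lambda>h. h \<bullet> v x)) (at x)" "(u has_derivative (\<lambda>h. h \<bullet> w x)) (at x)"
      using that(3,4) by (simp_all add: grad_on_def gderiv_def)
    then have "(\<lambda>h. h \<bullet> v x) = (\<lambda>h. h \<bullet> w x)" by (rule has_derivative_unique)
    then show "v x = w x" by (metis vector_eq_ldot)
  qed simp
  have u2: "v = w" if "v \<in> vector_fields one_F" "w \<in> vector_fields one_F" "curl_on off_planes u v" "curl_on off_planes u w" for u v w
    by (rule vector_fields_determined[OF _ that(1,2)]) (use that(3,4) in \<open>auto simp: curl_on_def Let_def\<close>)
  have u3: "v = w" if "v \<in> range (tensor_sum \<beta> G)" "w \<in> range (tensor_sum \<beta> G)" "div_on off_planes u v" "div_on off_planes u w" for u v w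
    by (rule tensor_sum_determined[OF admissible_G that(1,2)]) (use that(3,4) in \<open>auto simp: div_on_def\<close>)
  let ?inv = "\<lambda>S. inv_into (functions_on_cells S)"
  show ?thesis
  proof (intro exI conjI)
    show "linear_iso (range (tensor_sum \<beta> F)) (functions_on_cells (cell_box F)) (?inv (cell_box F) (scalar_field F))"
      by (rule linear_iso_inv_into[OF b0 scalar_field_linear])
    show "linear_iso (vector_fields one_G) (functions_on_cells C1) (?inv C1 (vector_field one_G sign1))"
      by (rule linear_iso_inv_into[OF b1 vector_field_linear])
    show "linear_iso (vector_fields one_F) (functions_on_cells C2) (?inv C2 (vector_field one_F sign2))"
      by (rule linear_iso_inv_into[OF b2 vector_field_linear])
    show "linear_iso (range (tensor_sum \<beta> G)) (functions_on_cells (cell_box G)) (?inv (cell_box G) (scalar_field G))"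
      by (rule linear_iso_inv_into[OF b3 scalar_field_linear])
    show "intertwines (range (tensor_sum \<beta> F)) (grad_on off_planes) (vector_fields one_G)
        (?inv (cell_box F) (scalar_field F)) (cell_map (cell_box F) C1) (?inv C1 (vector_field one_G sign1))"
      by (rule intertwines_inv_into[OF b0 b1 _ u1]) (simp add: cell_map_in grad_scalar_field)
    show "intertwines (vector_fields one_G) (curl_on off_planes) (vector_fields one_F)
        (?inv C1 (vector_field one_G sign1)) (cell_map C1 C2) (?inv C2 (vector_field one_F sign2))"
      by (rule intertwines_inv_into[OF b1 b2 _ u2]) (simp add: cell_map_in curl_vector_field)
    show "intertwines (vector_fields one_F) (div_on off_planes) (range (tensor_sum \<beta> G))
        (?inv C2 (vector_field one_F sign2)) (cell_map C2 (cell_box G)) (?inv (cell_box G) (scalar_field G))"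
      by (rule intertwines_inv_into[OF b2 b3 _ u3]) (simp add: cell_map_in div_vector_field)
  qed
qed

end

section \<open>Labelling the basis functions by mesh cells\<close>

text \<open>If w counts the factors in G, the product cells are sorted by their total weight.\<close>
lemma cells_by_weight:
  fixes F G :: "3 \<Rightarrow> cell1 set" and w :: "cell1 \<Rightarrow> nat"
  assumes "\<And>l a. a \<in> F l \<Longrightarrow> w a = 0" "\<And>l b. b \<in> G l \<Longrightarrow> w b = 1"
  defines "S \<equiv> \<lambda>k. {(a, b, c). a \<in> F 1 \<union> G 1 \<and> b \<in> F 2 \<union> G 2 \<and> c \<in> F 3 \<union> G 3 \<and> w a + w b + w c = k}"
  shows "S 0 = cell_box F" "S 1 = (\<Union>k. cell_box (F(k := G k)))"
    "S 2 = (\<Union>k. cell_box (G(k := F k)))" "S 3 = cell_box G"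
proof -
  have *: "(a, b, c) \<in> S k \<longleftrightarrow> (a \<in> F 1 \<or> a \<in> G 1) \<and> (b \<in> F 2 \<or> b \<in> G 2) \<and> (c \<in> F 3 \<or> c \<in> G 3) \<and> w a + w b + w c = k"
    for a b c k by (simp add: S_def)
  have "(a, b, c) \<in> S 0 \<longleftrightarrow> (a, b, c) \<in> cell_box F" for a b c
    unfolding * by (auto simp: cell_box_def assms(1,2))
  then show "S 0 = cell_box F" by auto
  have "(a, b, c) \<in> S 1 \<longleftrightarrow> (a, b, c) \<in> (\<Union>k. cell_box (F(k := G k)))" for a b c
    unfolding * by (auto simp: cell_box_def ex_3 assms(1,2))
  then show "S 1 = (\<Union>k. cell_box (F(k := G k)))" by auto
  have "(a, b, c) \<in> S 2 \<longleftrightarrow> (a, b, c) \<in> (\<Union>k. cell_box (G(k := F k)))" for a b c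
    unfolding * by (auto simp: cell_box_def ex_3 assms(1,2))
  then show "S 2 = (\<Union>k. cell_box (G(k := F k)))" by auto
  have "(a, b, c) \<in> S 3 \<longleftrightarrow> (a, b, c) \<in> cell_box G" for a b c
    unfolding * by (auto simp: cell_box_def assms(1,2))
  then show "S 3 = cell_box G" by auto
qed

lemma labelled_splines_complex:
  fixes n :: "3 \<Rightarrow> nat" and \<xi> :: "3 \<Rightarrow> nat \<Rightarrow> real"
  assumes L: "\<And>l. labelled_splines p (n l) (\<xi> l) f g (\<beta> l) J e"
    and e: "e * e = 1" and \<omega>: "orientation \<omega>"
    and signs: "\<And>i. (- 1) ^ dim1 (f i) = e" "\<And>i. (- 1) ^ dim1 (g i) = - e"
    and F: "\<And>l. F l = f ` {1..n l}" and G: "\<And>l. G l = g ` {2..n l}"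
  shows "spline_complex_isomorphic p n \<xi>
     (functions_on_cells (cell_box F)) (signed_cell_map J \<omega> (cell_box F) (\<Union>k. cell_box (F(k := G k))))
     (functions_on_cells (\<Union>k. cell_box (F(k := G k))))
       (signed_cell_map J \<omega> (\<Union>k. cell_box (F(k := G k))) (\<Union>k. cell_box (G(k := F k))))
     (functions_on_cells (\<Union>k. cell_box (G(k := F k))))
       (signed_cell_map J \<omega> (\<Union>k. cell_box (G(k := F k))) (cell_box G))
     (functions_on_cells (cell_box G))"
proof -
  define K where "K l = \<xi> l ` {1..n l + p + 1}" for l
  have O: "open_knots p (n l) (\<xi> l)" for l using L[of l] by (simp add: labelled_splines_def)
  have off_knots: "{0<..<1} - K l = open_knots.off_knots p (n l) (\<xi> l)" for l
    by (simp add: K_def open_knots.off_knots_def[OF O])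
  interpret tensor_complex F G \<beta> K J e \<omega>
  proof
    fix l a b t and q :: "cell1 \<Rightarrow> real"
    show "finite (F l)" "finite (G l)" by (simp_all add: F G)
    show "a \<in> F l \<Longrightarrow> (- 1) ^ dim1 a = e" "b \<in> G l \<Longrightarrow> (- 1) ^ dim1 b = - e"
      using signs by (auto simp: F G)
    show "e * e = 1" "orientation \<omega>" by fact+
    show "\<lbrakk>a \<in> F l; t \<in> {0<..<1} - K l\<rbrakk> \<Longrightarrow>
        (\<beta> l a has_real_derivative e * (\<Sum>b\<in>G l. J a b * \<beta> l b t)) (at t)"
      unfolding off_knots F G by (rule labelled_splines.deriv_f[OF L])
    show "\<lbrakk>b \<in> G l; t \<in> {0<..<1} - K l\<rbrakk> \<Longrightarrow> \<exists>D. (\<beta> l b has_real_derivative D) (at t)"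
      unfolding off_knots G by (rule labelled_splines.deriv_g[OF L])
    show "\<lbrakk>\<And>t. t \<in> {0<..<1} - K l \<Longrightarrow> (\<Sum>a\<in>F l. q a * \<beta> l a t) = 0; a \<in> F l\<rbrakk> \<Longrightarrow> q a = 0"
      unfolding off_knots F by (rule labelled_splines.indep_f[OF L])
    show "\<lbrakk>\<And>t. t \<in> {0<..<1} - K l \<Longrightarrow> (\<Sum>b\<in>G l. q b * \<beta> l b t) = 0; b \<in> G l\<rbrakk> \<Longrightarrow> q b = 0"
      unfolding off_knots G by (rule labelled_splines.indep_g[OF L])
  qed
  have V: "spline_space p (n l) (\<xi> l) = {s. \<exists>c. s = (\<lambda>t. \<Sum>a\<in>F l. c a * \<beta> l a t)}"
    and W: "trimmed_spline_space p (n l) (\<xi> l) = {s. \<exists>c. s = (\<lambda>t. \<Sum>a\<in>G l. c a * \<beta> l a t)}" for l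
    unfolding F G
    by (rule labelled_splines.spline_space_f[OF L] labelled_splines.trimmed_spline_space_g[OF L])+
  have X0: "X0h p n \<xi> = range (tensor_sum \<beta> F)"
    unfolding X0h_def by (rule tensor_space_eq_range) (use finite_F V in auto)
  have X3: "X3h p n \<xi> = range (tensor_sum \<beta> G)"
    unfolding X3h_def by (rule tensor_space_eq_range) (use finite_G W in auto)
  have "tensor_space (\<lambda>l. if l = k then trimmed_spline_space p (n l) (\<xi> l) else spline_space p (n l) (\<xi> l)) =
      range (tensor_sum \<beta> (F(k := G k)))" for k
    by (rule tensor_space_eq_range) (use finite_F finite_G V W in auto)
  then have X1: "X1h p n \<xi> = vector_fields (\<lambda>k. F(k := G k))"
    unfolding X1h_def vector_fields_def by simp
  have "tensor_space (\<lambda>l. if l = k then spline_space p (n l) (\<xi> l) else trimmed_spline_space p (n l) (\<xi> l)) =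
      range (tensor_sum \<beta> (G(k := F k)))" for k
    by (rule tensor_space_eq_range) (use finite_F finite_G V W in auto)
  then have X2: "X2h p n \<xi> = vector_fields (\<lambda>k. G(k := F k))"
    unfolding X2h_def vector_fields_def by simp
  have off_planes: "off_knot_planes p n \<xi> = off_planes"
    unfolding off_knot_planes_def off_planes_def K_def by simp
  show ?thesis
    unfolding spline_complex_isomorphic_def X0 X1 X2 X3 off_planes
    using complex_isomorphism unfolding C1_def C2_def .
qed

text \<open>
  The index shift takes the first B-spline to the first vertex, with index \<open>(p + 1) div 2 + 1\<close>,
  and \<open>M\<^sub>2\<close> to the first edge, which has the same index.
\<close>
lemma odd_labelled_splines:
  assumes "open_knots p n \<xi>" "odd p"
  shows "labelled_splines p n \<xi> (\<lambda>i. Vertex (i + (p + 1) div 2)) (\<lambda>i. Edge (i - 1 + (p + 1) div 2))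
    (\<lambda>a. case a of Vertex j \<Rightarrow> bspline \<xi> p (j - (p + 1) div 2)
       | Edge j \<Rightarrow> M_spline p \<xi> (j - (p + 1) div 2 + 1)) incidence1 1"
proof -
  interpret open_knots p n \<xi> by fact
  show ?thesis by unfold_locales (auto simp: inj_on_def)
qed

text \<open>
  The first B-spline belongs to the first edge, with index \<open>p div 2 + 1\<close>, and \<open>M\<^sub>2\<close> to the first
  interior vertex, whose index is larger by 1.
\<close>
lemma even_labelled_splines:
  assumes "open_knots p n \<xi>" "even p"
  shows "labelled_splines p n \<xi> (\<lambda>i. Edge (i + p div 2)) (\<lambda>i. Vertex (i + p div 2))
    (\<lambda>a. case a of Edge j \<Rightarrow> bspline \<xi> p (j - p div 2)
       | Vertex j \<Rightarrow> M_spline p \<xi> (j - p div 2)) (\<lambda>a b. incidence1 b a) (- 1)"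
proof -
  interpret open_knots p n \<xi> by fact
  show ?thesis by unfold_locales (auto simp: inj_on_def)
qed

lemma coboundary_eq: "coboundary \<omega> = signed_cell_map incidence1 \<omega>"
proof -
  have "cell_incidence incidence1 \<sigma> \<tau> = product_incidence \<sigma> \<tau>" for \<sigma> \<tau>
    by (cases \<sigma>; cases \<tau>) simp
  then show ?thesis
    by (intro ext) (simp add: coboundary_def signed_cell_map_def incidence_def mult.assoc)
qed

lemma boundary_map_eq: "boundary_map \<omega> = signed_cell_map (\<lambda>a b. incidence1 b a) \<omega>"
proof -
  have "cell_incidence (\<lambda>a b. incidence1 b a) \<sigma> \<tau> = product_incidence \<tau> \<sigma>" for \<sigma> \<tau>
    by (cases \<sigma>; cases \<tau>) auto
  then show ?thesis
    by (intro ext) (simp add: boundary_map_def signed_cell_map_def incidence_def mult_ac)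
qed

lemma mesh1_odd:
  assumes "odd p"
  shows "mesh1 p n = (\<lambda>i. Vertex (i + (p + 1) div 2)) ` {1..n} \<union> (\<lambda>i. Edge (i - 1 + (p + 1) div 2)) ` {2..n}"
proof -
  define r where "r = (p + 1) div 2"
  have fl: "first_vertex p = r + 1" "last_vertex p n = n + r"
    using assms by (auto simp: first_vertex_def last_vertex_def r_def elim!: oddE)
  have "(\<lambda>i. i + r) ` {1..n} = {r + 1..n + r}"
    unfolding image_add_atLeastAtMost' by (simp add: add.commute)
  then have "(\<lambda>i. Vertex (i + r)) ` {1..n} = Vertex ` {r + 1..n + r}"
    by (metis image_image)
  moreover have "(\<lambda>i. i - 1 + r) ` {2..n} = {r + 1..<n + r}"
  proof (intro equalityI subsetI)
    fix x assume "x \<in> {r + 1..<n + r}"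
    then have "x = (x - r + 1) - 1 + r" "x - r + 1 \<in> {2..n}" by auto
    then show "x \<in> (\<lambda>i. i - 1 + r) ` {2..n}" by (rule image_eqI)
  qed auto
  then have "(\<lambda>i. Edge (i - 1 + r)) ` {2..n} = Edge ` {r + 1..<n + r}"
    by (metis image_image)
  ultimately show ?thesis unfolding mesh1_def fl r_def[symmetric] by simp
qed

lemma mesh1_even:
  assumes "even p"
  shows "mesh1 p n - boundary_vertices1 p n =
      (\<lambda>i. Edge (i + p div 2)) ` {1..n} \<union> (\<lambda>i. Vertex (i + p div 2)) ` {2..n}"
    and "{a \<in> mesh1 p n. dim1 a = 1} = (\<lambda>i. Edge (i + p div 2)) ` {1..n}"
proof -
  define r where "r = p div 2"
  have fl: "first_vertex p = r + 1" "last_vertex p n = n + r + 1"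
    using assms by (auto simp: first_vertex_def last_vertex_def r_def elim!: evenE)
  have "(\<lambda>i. i + r) ` {1..n} = {r + 1..<n + r + 1}" "(\<lambda>i. i + r) ` {2..n} = {r + 2..n + r}"
    unfolding image_add_atLeastAtMost' by auto
  then have E: "(\<lambda>i. Edge (i + r)) ` {1..n} = Edge ` {r + 1..<n + r + 1}"
    and V: "(\<lambda>i. Vertex (i + r)) ` {2..n} = Vertex ` {r + 2..n + r}"
    by (metis image_image)+
  show "mesh1 p n - boundary_vertices1 p n =
      (\<lambda>i. Edge (i + p div 2)) ` {1..n} \<union> (\<lambda>i. Vertex (i + p div 2)) ` {2..n}"
    unfolding mesh1_def boundary_vertices1_def fl r_def[symmetric] E V by auto
  show "{a \<in> mesh1 p n. dim1 a = 1} = (\<lambda>i. Edge (i + p div 2)) ` {1..n}"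
    unfolding mesh1_def fl r_def[symmetric] E by auto
qed

theorem proposition4p2:
  fixes p :: nat and n :: "3 \<Rightarrow> nat" and \<xi> :: "3 \<Rightarrow> nat \<Rightarrow> real" and \<omega> :: "cell \<Rightarrow> real"
  assumes "1 \<le> p"
    and "\<And>l. open_knot_vector p (n l) (\<xi> l)"
    and "\<And>l. internal_multiplicities_le p p (n l) (\<xi> l)"
    and "orientation \<omega>"
  shows "(odd p \<longrightarrow> isomorphic_to_cochain_complex p n \<xi> \<omega>) \<and>
         (even p \<longrightarrow> isomorphic_to_interior_chain_complex p n \<xi> \<omega>)"
proof -
  have O: "open_knots p (n l) (\<xi> l)" for l
    using assms by (simp add: open_knots_def)
  show ?thesis
  proof (intro conjI impI)
    assume "odd p"
    define F where "F l = (\<lambda>i. Vertex (i + (p + 1) div 2)) ` {1..n l}" for l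
    define G where "G l = (\<lambda>i. Edge (i - 1 + (p + 1) div 2)) ` {2..n l}" for l
    have mesh: "mesh1 p (n l) = F l \<union> G l" for l
      unfolding F_def G_def by (rule mesh1_odd[OF \<open>odd p\<close>])
    have "mesh_cells p n k = {(a, b, c). a \<in> F 1 \<union> G 1 \<and> b \<in> F 2 \<union> G 2 \<and> c \<in> F 3 \<union> G 3 \<and>
        dim1 a + dim1 b + dim1 c = k}" for k
      unfolding mesh_cells_def mesh by auto
    note cells = this cells_by_weight[of F dim1 G]
    have K: "mesh_cells p n 0 = cell_box F" "mesh_cells p n 1 = (\<Union>k. cell_box (F(k := G k)))"
      "mesh_cells p n 2 = (\<Union>k. cell_box (G(k := F k)))" "mesh_cells p n 3 = cell_box G"
      unfolding cells(1) by (rule cells(2-); auto simp: F_def G_def)+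
    show "isomorphic_to_cochain_complex p n \<xi> \<omega>"
      unfolding isomorphic_to_cochain_complex_def Let_def K coboundary_eq
      by (rule labelled_splines_complex[OF odd_labelled_splines[OF O \<open>odd p\<close>] _ assms(4)])
        (simp_all add: F_def G_def)
  next
    assume "even p"
    define F where "F l = (\<lambda>i. Edge (i + p div 2)) ` {1..n l}" for l
    define G where "G l = (\<lambda>i. Vertex (i + p div 2)) ` {2..n l}" for l
    have dimF: "dim1 a = 1" if "a \<in> F l" for a l using that by (auto simp: F_def)
    have dimG: "dim1 a = 0" if "a \<in> G l" for a l using that by (auto simp: G_def)
    have mesh: "mesh1 p (n l) - boundary_vertices1 p (n l) = F l \<union> G l"
      "{a \<in> mesh1 p (n l). dim1 a = 1} = F l" for l
      unfolding F_def G_def by (rule mesh1_even[OF \<open>even p\<close>])+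
    \<comment> \<open>Now factors in G are vertices, so the number of factors in G is the codimension.\<close>
    have I: "interior_cells p n k = {(a, b, c). a \<in> F 1 \<union> G 1 \<and> b \<in> F 2 \<union> G 2 \<and> c \<in> F 3 \<union> G 3 \<and>
        (1 - dim1 a) + (1 - dim1 b) + (1 - dim1 c) = 3 - k}" if "k \<le> 3" for k
    proof -
      have "dim1 a + dim1 b + dim1 c = k \<longleftrightarrow> (1 - dim1 a) + (1 - dim1 b) + (1 - dim1 c) = 3 - k" for a b c
        using that by (cases a; cases b; cases c) auto
      then show ?thesis
        unfolding interior_cells_def mesh_cells_def mesh(1)[symmetric] by auto
    qed
    note cells = cells_by_weight[of F "\<lambda>a. 1 - dim1 a" G, OF _ _]
    have K: "interior_cells p n 0 = cell_box G" "interior_cells p n 1 = (\<Union>k. cell_box (G(k := F k)))"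
      "interior_cells p n 2 = (\<Union>k. cell_box (F(k := G k)))"
      using cells(4) cells(3) cells(2) by (simp_all add: I dimF dimG)
    have "(a, b, c) \<in> mesh_cells p n 3 \<longleftrightarrow> (a, b, c) \<in> cell_box F" for a b c
    proof -
      have "dim1 a + dim1 b + dim1 c = 3 \<longleftrightarrow> dim1 a = 1 \<and> dim1 b = 1 \<and> dim1 c = 1"
        by (cases a; cases b; cases c) auto
      then show ?thesis
        unfolding mesh_cells_def cell_box_def mesh(2)[symmetric] by auto
    qed
    then have E: "mesh_cells p n 3 = cell_box F" by auto
    show "isomorphic_to_interior_chain_complex p n \<xi> \<omega>"
      unfolding isomorphic_to_interior_chain_complex_def Let_def K E boundary_map_eq
      by (rule labelled_splines_complex[OF even_labelled_splines[OF O \<open>even p\<close>] _ assms(4)])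
        (simp_all add: F_def G_def)
  qed
qed

end
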